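(* Let $a,b,\mu\in\mathbb{R}$ with $ab<0$. The equation $x'=f(x)+\mu\sin t$ has exactly three limit cycles, each of them located in a zone of linearity, if and only if $$|\mu|\le\min\left\{\frac{-b\sqrt{a^2+1}}{a},\ \sqrt{b^2+1}\right\}.$$ These three limit cycles are hyperbolic; those in the zones $x\ge 1$ and $x\le -1$ are asymptotically stable when $b>0$ and unstable when $b<0$, and the limit cycle contained in the region $|x|\le 1$ is asymptotically stable when $b<0$ and unstable when $b>0$.
   Context: For $a,b\in\mathbb{R}$, the function $f:\mathbb{R}\to\mathbb{R}$ is the continuous odd piecewise linear function $$f(x)=\begin{cases} ax+(a-b), & x\le -1,\\ bx, & -1<x<1,\\ ax+(b-a), & x\ge 1.\end{cases}$$ For $\mu\in\mathbb{R}$, consider the scalar $2\pi$-periodic differential equation $x'=f(x)+\mu\sin t$; let $u(t,\tau,x)$ be its solution with $u(\tau,\tau,x)=x$ (defined for all $t$), $P(x)=u(2\pi,0,x)$ and $d(x)=P(x)-x$. "Periodic solution" means $2\pi$-periodic solution (constant solutions included). A limit cycle is an isolated periodic solution, i.e. one whose value at $t=0$ is an isolated zero of $d$; a periodic solution $u(t,0,\bar x)$ is hyperbolic if $P'(\bar x)\ne 1$. The zones of linearity are $x\le -1$, $|x|\le 1$ and $x\ge 1$; a solution is located in a zone if all its values for $t\in\mathbb{R}$ belong to that zone. *)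

theory Defs
  imports "HOL-Analysis.Analysis"
begin

definition pwl :: "real \<Rightarrow> real \<Rightarrow> real \<Rightarrow> real" where
  "pwl a b x =
     (if x \<le> -1 then a * x + (a - b)
      else if x < 1 then b * x
      else a * x + (b - a))"

definition solution :: "real \<Rightarrow> real \<Rightarrow> real \<Rightarrow> (real \<Rightarrow> real) \<Rightarrow> bool" where
  "solution a b \<mu> \<phi> \<longleftrightarrow>
     (\<forall>t. (\<phi> has_real_derivative (pwl a b (\<phi> t) + \<mu> * sin t)) (at t))"

(* The right-hand side is continuous in t and globally Lipschitz in x, so each initial
   value problem has exactly one solution on the whole line; this is the function
   picked by THE.  The arguments t, s, x are ordered as in u(t, tau, x), with s for tau. *)
definition u :: "real \<Rightarrow> real \<Rightarrow> real \<Rightarrow> real \<Rightarrow> real \<Rightarrow> real \<Rightarrow> real" where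
  "u a b \<mu> t s x = (THE \<phi>. solution a b \<mu> \<phi> \<and> \<phi> s = x) t"

definition poincare :: "real \<Rightarrow> real \<Rightarrow> real \<Rightarrow> real \<Rightarrow> real" where
  "poincare a b \<mu> x = u a b \<mu> (2 * pi) 0 x"

definition displacement :: "real \<Rightarrow> real \<Rightarrow> real \<Rightarrow> real \<Rightarrow> real" where
  "displacement a b \<mu> x = poincare a b \<mu> x - x"

definition periodic_solution :: "real \<Rightarrow> real \<Rightarrow> real \<Rightarrow> (real \<Rightarrow> real) \<Rightarrow> bool" where
  "periodic_solution a b \<mu> \<phi> \<longleftrightarrow>
     solution a b \<mu> \<phi> \<and> (\<forall>t. \<phi> (t + 2 * pi) = \<phi> t)"

definition limit_cycle :: "real \<Rightarrow> real \<Rightarrow> real \<Rightarrow> (real \<Rightarrow> real) \<Rightarrow> bool" where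
  "limit_cycle a b \<mu> \<phi> \<longleftrightarrow>
     periodic_solution a b \<mu> \<phi> \<and> \<phi> 0 isolated_in {x. displacement a b \<mu> x = 0}"

(* Hyperbolicity includes the existence of the derivative of the Poincare map. *)
definition hyperbolic :: "real \<Rightarrow> real \<Rightarrow> real \<Rightarrow> (real \<Rightarrow> real) \<Rightarrow> bool" where
  "hyperbolic a b \<mu> \<phi> \<longleftrightarrow>
     (\<exists>D. (poincare a b \<mu> has_real_derivative D) (at (\<phi> 0)) \<and> D \<noteq> 1)"

definition located_in :: "(real \<Rightarrow> real) \<Rightarrow> real set \<Rightarrow> bool" where
  "located_in \<phi> Z \<longleftrightarrow> (\<forall>t. \<phi> t \<in> Z)"

definition linearity_zones :: "real set set" where
  "linearity_zones = {{..-1}, {-1..1}, {1..}}"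

(* Stability is in the sense of Lyapunov, forward in time, for every initial time s. *)
definition stable :: "real \<Rightarrow> real \<Rightarrow> real \<Rightarrow> (real \<Rightarrow> real) \<Rightarrow> bool" where
  "stable a b \<mu> \<phi> \<longleftrightarrow>
     (\<forall>s. \<forall>\<epsilon>>0. \<exists>\<delta>>0. \<forall>x. \<bar>x - \<phi> s\<bar> < \<delta> \<longrightarrow>
        (\<forall>t\<ge>s. \<bar>u a b \<mu> t s x - \<phi> t\<bar> < \<epsilon>))"

definition asymptotically_stable :: "real \<Rightarrow> real \<Rightarrow> real \<Rightarrow> (real \<Rightarrow> real) \<Rightarrow> bool" where
  "asymptotically_stable a b \<mu> \<phi> \<longleftrightarrow>
     stable a b \<mu> \<phi> \<and>
     (\<forall>s. \<exists>\<delta>>0. \<forall>x. \<bar>x - \<phi> s\<bar> < \<delta> \<longrightarrow>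
        ((\<lambda>t. u a b \<mu> t s x - \<phi> t) \<longlongrightarrow> 0) at_top)"

definition unstable :: "real \<Rightarrow> real \<Rightarrow> real \<Rightarrow> (real \<Rightarrow> real) \<Rightarrow> bool" where
  "unstable a b \<mu> \<phi> \<longleftrightarrow> \<not> stable a b \<mu> \<phi>"

end

theory Submission
  imports Defs
begin

text \<open>On a linear piece \<open>x' = s x + k + \<mu> sin t\<close> has exactly one periodic solution, a sinusoid of
  amplitude \<open>|\<mu>| / sqrt (s\<^sup>2 + 1)\<close> around \<open>- k / s\<close>. The bound on \<open>|\<mu>|\<close> says precisely that the
  sinusoids of the three pieces stay in their zones. Three limit cycles located in zones can only
  be these sinusoids, which gives necessity.

  Conversely, a sinusoid located in its zone touches the boundary only at countably many times, so
  the Poincare map has derivative \<open>exp (2 pi s) \<noteq> 1\<close> there. No further periodic solution \<open>\<psi>\<close> exists: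
  between the middle orbit \<open>m\<close> and the right orbit \<open>r\<close> the vector field is concave or convex in
  \<open>x\<close>, so \<open>ln (\<psi> - m) - ln (r - \<psi>)\<close> would be monotone but not constant; the symmetry
  \<open>x(t) \<mapsto> - x(t + pi)\<close> covers the left side.\<close>

section \<open>Global existence for Lipschitz equations\<close>

lemma mono_of_DERIV_nonneg:
  fixes H h :: "real \<Rightarrow> real"
  assumes "\<And>t. (H has_real_derivative h t) (at t)" "\<And>t. 0 \<le> h t"
  shows "mono H"
proof
  fix x y :: real assume "x \<le> y"
  with assms show "H x \<le> H y" by (intro DERIV_nonneg_imp_nondecreasing[of x y H]) auto
qed

text \<open>Comparison with the antiderivative \<open>C / K * sinh (K * (t - s))\<close>, whose
  absolute value is at most the same multiple of \<open>cosh\<close>. The gain of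
  \<open>1 / K\<close> is what makes the Picard operator contract; the sign \<open>\<sigma>\<close>
  treats \<open>G\<close> and \<open>- G\<close> at once.\<close>

lemma abs_le_cosh_of_DERIV_le_cosh:
  fixes G g :: "real \<Rightarrow> real"
  assumes K: "K > 0"
    and G: "\<And>t. (G has_real_derivative g t) (at t)" and G0: "G s = 0"
    and bd: "\<And>t. \<bar>g t\<bar> \<le> C * cosh (K * (t - s))"
  shows "\<bar>G t\<bar> \<le> C / K * cosh (K * (t - s))"
proof -
  have C: "C \<ge> 0" using bd[of s] by simp
  have mono: "mono (\<lambda>t. C / K * sinh (K * (t - s)) + \<sigma> * G t)" if \<sigma>: "\<bar>\<sigma>\<bar> = 1" for \<sigma>
  proof (rule mono_of_DERIV_nonneg)
    show "((\<lambda>t. C / K * sinh (K * (t - s)) + \<sigma> * G t) has_real_derivative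
            C * cosh (K * (t - s)) + \<sigma> * g t) (at t)" for t
      using K by (auto intro!: derivative_eq_intros G)
    show "0 \<le> C * cosh (K * (t - s)) + \<sigma> * g t" for t
      using bd[of t] \<sigma> by (auto simp: abs_if split: if_splits)
  qed
  have 1: "\<sigma> * G t \<le> C / K * \<bar>sinh (K * (t - s))\<bar>" if \<sigma>: "\<bar>\<sigma>\<bar> = 1" for \<sigma>
  proof (cases "s \<le> t")
    case True
    have "\<bar>-\<sigma>\<bar> = 1" using \<sigma> by simp
    from monoD[OF mono[OF this] True] have "\<sigma> * G t \<le> C / K * sinh (K * (t - s))" using G0 by simp
    also have "\<dots> \<le> C / K * \<bar>sinh (K * (t - s))\<bar>" using C K by (intro mult_left_mono) auto
    finally show ?thesis .
  next
    case False
    then have "t \<le> s" by simp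
    from monoD[OF mono[OF \<sigma>] this] have "\<sigma> * G t \<le> C / K * - sinh (K * (t - s))" using G0 by simp
    also have "\<dots> \<le> C / K * \<bar>sinh (K * (t - s))\<bar>" using C K by (intro mult_left_mono) auto
    finally show ?thesis .
  qed
  have "\<bar>G t\<bar> \<le> C / K * \<bar>sinh (K * (t - s))\<bar>" using 1[of 1] 1[of "-1"] by auto
  also have "\<dots> \<le> C / K * cosh (K * (t - s))"
  proof (intro mult_left_mono)
    show "\<bar>sinh (K * (t - s))\<bar> \<le> cosh (K * (t - s))"
      using sinh_le_cosh_real[of "K * (t - s)"] sinh_le_cosh_real[of "- (K * (t - s))"] by auto
  qed (use C K in auto)
  finally show ?thesis .
qed

lemma continuous_antiderivative:
  fixes g :: "real \<Rightarrow> real"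
  assumes "continuous_on UNIV g"
  obtains G where "\<And>t. (G has_real_derivative g t) (at t)" "G s = x"
proof -
  have c: "isCont g t" for t
    using assms continuous_on_eq_continuous_at[OF open_UNIV] by blast
  have "\<exists>F. \<forall>t. - \<infinity> < ereal t \<longrightarrow> ereal t < \<infinity> \<longrightarrow> (F has_vector_derivative g t) (at t)"
    by (rule einterval_antiderivative) (simp_all add: c)
  then obtain F where F: "\<And>t. (F has_vector_derivative g t) (at t)" by auto
  show thesis
  proof
    show "((\<lambda>t. F t - F s + x) has_real_derivative g t) (at t)" for t
      using DERIV_add[OF DERIV_diff[OF F[of t, folded has_real_derivative_iff_has_vector_derivative] DERIV_const[of "F s"]] DERIV_const[of x]]
      by simp
  qed simp
qed

text \<open>Banach's theorem for the functions that are bounded after division by the weight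
  \<open>cosh (2 L (t - s))\<close>, in which the Picard operator contracts by \<open>1/2\<close> on the whole line.\<close>

lemma lipschitz_ivp_solvable:
  fixes f p :: "real \<Rightarrow> real"
  assumes L: "L > 0" and lip: "\<And>x y. \<bar>f x - f y\<bar> \<le> L * \<bar>x - y\<bar>"
    and p: "continuous_on UNIV p" and M: "\<And>t. \<bar>p t\<bar> \<le> M"
  shows "\<exists>\<phi>. \<phi> s = x \<and> (\<forall>t. (\<phi> has_real_derivative (f (\<phi> t) + p t)) (at t))"
proof -
  define K where "K = 2 * L"
  have K: "K > 0" using L by (simp add: K_def)
  define w where "w t = cosh (K * (t - s))" for t
  have w1: "w t \<ge> 1" for t by (simp add: w_def cosh_real_ge_1)
  have w0: "w t > 0" for t using w1[of t] by linarith
  have wc: "continuous_on UNIV w" unfolding w_def by (intro continuous_intros)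
  have fc: "continuous_on UNIV f"
  proof (rule continuous_onI)
    fix y e :: real assume "e > 0"
    then show "\<exists>d>0. \<forall>z\<in>UNIV. dist z y < d \<longrightarrow> dist (f z) (f y) \<le> e"
      using L order_trans[OF lip]
      by (intro exI[of _ "e / L"]) (auto simp: dist_real_def field_simps less_imp_le)
  qed
  \<comment> \<open>A point \<open>\<psi>\<close> of the Banach space is a curve divided by
    \<open>w\<close>; the curve itself is \<open>w * \<psi>\<close>, and \<open>g \<psi>\<close> is
    the right-hand side along it.\<close>
  define g where "g \<psi> t = f (w t * apply_bcontfun \<psi> t) + p t" for \<psi> :: "(real, real) bcontfun" and t
  have gc: "continuous_on UNIV (g \<psi>)" for \<psi>
    unfolding g_def using wc
    by (intro continuous_intros p continuous_on_compose2[OF fc]) auto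
  have "\<exists>G. (\<forall>t. (G has_real_derivative g \<psi> t) (at t)) \<and> G s = x" for \<psi>
    using continuous_antiderivative[OF gc] by metis
  then obtain G where G: "\<And>\<psi> t. (G \<psi> has_real_derivative g \<psi> t) (at t)" and Gs: "\<And>\<psi>. G \<psi> s = x"
    by metis
  have Gc: "continuous_on UNIV (G \<psi>)" for \<psi>
    using DERIV_isCont[OF G] continuous_on_eq_continuous_at[OF open_UNIV] by blast
  have bc: "(\<lambda>t. G \<psi> t / w t) \<in> bcontfun" for \<psi>
  proof -
    \<comment> \<open>Linear growth of \<open>f\<close> together with \<open>w \<ge> 1\<close>
      absorbs all constants into the weight, so the Picard image divided by \<open>w\<close> stays
      bounded.\<close>
    let ?C = "L * norm \<psi> + \<bar>f 0\<bar> + M"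
    have "\<bar>g \<psi> t\<bar> \<le> ?C * cosh (K * (t - s))" for t
    proof -
      have "\<bar>f (w t * apply_bcontfun \<psi> t)\<bar> \<le> L * \<bar>w t * apply_bcontfun \<psi> t\<bar> + \<bar>f 0\<bar>"
        using lip[of "w t * apply_bcontfun \<psi> t" 0] by auto
      also have "L * \<bar>w t * apply_bcontfun \<psi> t\<bar> \<le> L * norm \<psi> * w t"
        using norm_bounded[of \<psi> t] w0[of t] L by (simp add: abs_mult mult.commute)
      finally have "\<bar>g \<psi> t\<bar> \<le> L * norm \<psi> * w t + \<bar>f 0\<bar> + M"
        unfolding g_def using M[of t] by linarith
      also have "\<bar>f 0\<bar> + M \<le> (\<bar>f 0\<bar> + M) * w t"
        using M[of t] w1[of t] by (intro mult_le_cancel_left1[THEN iffD2]) auto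
      then have "L * norm \<psi> * w t + \<bar>f 0\<bar> + M \<le> ?C * w t" by (simp add: algebra_simps)
      finally show ?thesis by (simp add: w_def)
    qed
    moreover have "((\<lambda>t. G \<psi> t - x) has_real_derivative g \<psi> t) (at t)" for t
      by (auto intro!: derivative_eq_intros G)
    ultimately have "\<bar>G \<psi> t - x\<bar> \<le> ?C / K * w t" for t
      unfolding w_def using abs_le_cosh_of_DERIV_le_cosh[OF K, of "\<lambda>t. G \<psi> t - x" "g \<psi>" s ?C t] Gs
      by simp
    moreover have "\<bar>x\<bar> \<le> \<bar>x\<bar> * w t" for t using w1[of t] by (simp add: mult_le_cancel_left1)
    ultimately have "\<bar>G \<psi> t\<bar> \<le> (?C / K + \<bar>x\<bar>) * w t" for t
      unfolding distrib_right
      by (smt (verit))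
    then have "norm (G \<psi> t / w t) \<le> ?C / K + \<bar>x\<bar>" for t
      using w0[of t] by (simp add: pos_divide_le_eq)
    moreover have "continuous_on UNIV (\<lambda>t. G \<psi> t / w t)"
      using w0 by (intro continuous_intros Gc wc) (metis less_irrefl)
    ultimately show ?thesis by (intro bcontfun_normI)
  qed
  define T where "T \<psi> = Bcontfun (\<lambda>t. G \<psi> t / w t)" for \<psi>
  have T: "apply_bcontfun (T \<psi>) t = G \<psi> t / w t" for \<psi> t
    unfolding T_def using Bcontfun_inverse[OF bc] by simp
  have contr: "dist (T \<psi>) (T \<zeta>) \<le> 1/2 * dist \<psi> \<zeta>" for \<psi> \<zeta>
  proof (rule dist_bound)
    fix t
    have "\<bar>g \<psi> r - g \<zeta> r\<bar> \<le> L * dist \<psi> \<zeta> * cosh (K * (r - s))" for r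
    proof -
      have "\<bar>g \<psi> r - g \<zeta> r\<bar> \<le> L * \<bar>w r * apply_bcontfun \<psi> r - w r * apply_bcontfun \<zeta> r\<bar>"
        unfolding g_def using lip by simp
      also have "\<dots> = L * (w r * dist (apply_bcontfun \<psi> r) (apply_bcontfun \<zeta> r))"
        using w0[of r] by (simp add: dist_real_def abs_mult flip: right_diff_distrib)
      also have "\<dots> \<le> L * (w r * dist \<psi> \<zeta>)"
        using L w0[of r] by (intro mult_left_mono dist_bounded) auto
      finally show ?thesis by (simp add: w_def mult_ac)
    qed
    moreover have "((\<lambda>t. G \<psi> t - G \<zeta> t) has_real_derivative g \<psi> t - g \<zeta> t) (at t)" for t
      by (auto intro!: derivative_eq_intros G)
    ultimately have "\<bar>G \<psi> t - G \<zeta> t\<bar> \<le> L * dist \<psi> \<zeta> / K * w t"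
      unfolding w_def
      using abs_le_cosh_of_DERIV_le_cosh[OF K, of "\<lambda>t. G \<psi> t - G \<zeta> t" "\<lambda>t. g \<psi> t - g \<zeta> t" s "L * dist \<psi> \<zeta>" t] Gs
      by simp
    also have "L * dist \<psi> \<zeta> / K = 1/2 * dist \<psi> \<zeta>" using L by (simp add: K_def)
    finally show "dist (apply_bcontfun (T \<psi>) t) (apply_bcontfun (T \<zeta>) t) \<le> 1/2 * dist \<psi> \<zeta>"
      using w0[of t] by (simp add: T dist_real_def pos_divide_le_eq flip: diff_divide_distrib)
  qed
  then obtain \<psi> where \<psi>: "T \<psi> = \<psi>"
    using banach_fix_type[of "1/2" T] by auto
  \<comment> \<open>At the fixed point \<open>G \<psi> = w * \<psi>\<close>, so
    \<open>G \<psi>\<close> is the solution sought.\<close>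
  have "g \<psi> t = f (G \<psi> t) + p t" for t
    using T[of \<psi> t] w0[of t] unfolding g_def by (simp add: \<psi>)
  then show ?thesis using G[of \<psi>] Gs[of \<psi>] by (intro exI[of _ "G \<psi>"]) simp
qed

section \<open>Solutions of the piecewise linear equation\<close>

text \<open>\<open>k\<close> is the length of the part of the segment from \<open>x\<close> to
  \<open>y\<close> outside [-1, 1], where the slope is \<open>a\<close>; on the rest it is
  \<open>b\<close>. In the proof \<open>h\<close> is the signed excess of a point over [-1, 1],
  which is monotone.\<close>

lemma pwl_difference:
  obtains k where "0 \<le> k" "k \<le> \<bar>x - y\<bar>"
    "\<bar>pwl a b x - pwl a b y\<bar> = \<bar>b * (\<bar>x - y\<bar> - k) + a * k\<bar>"
proof -
  define h :: "real \<Rightarrow> real" where "h x = max (x - 1) 0 - max (- 1 - x) 0" for x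
  have p: "pwl a b x = b * x + (a - b) * h x" for x
    by (auto simp: pwl_def h_def max_def algebra_simps)
  show thesis
  proof
    show "0 \<le> \<bar>h x - h y\<bar>" "\<bar>h x - h y\<bar> \<le> \<bar>x - y\<bar>" by (auto simp: h_def max_def)
    show "\<bar>pwl a b x - pwl a b y\<bar> = \<bar>b * (\<bar>x - y\<bar> - \<bar>h x - h y\<bar>) + a * \<bar>h x - h y\<bar>\<bar>"
    proof (cases "x \<le> y")
      case True
      then have "h x \<le> h y" by (auto simp: h_def max_def)
      with True have e: "b * (\<bar>x - y\<bar> - \<bar>h x - h y\<bar>) + a * \<bar>h x - h y\<bar> = pwl a b y - pwl a b x"
        by (simp add: p algebra_simps)
      show ?thesis unfolding e by simp
    next
      case False
      then have "h y \<le> h x" by (auto simp: h_def max_def)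
      with False have e: "b * (\<bar>x - y\<bar> - \<bar>h x - h y\<bar>) + a * \<bar>h x - h y\<bar> = pwl a b x - pwl a b y"
        by (simp add: p algebra_simps)
      show ?thesis unfolding e by simp
    qed
  qed
qed

text \<open>The summand 1 keeps the constant positive even for \<open>a = b = 0\<close>.\<close>

definition lip_const :: "real \<Rightarrow> real \<Rightarrow> real" where
  "lip_const a b = \<bar>a\<bar> + \<bar>b\<bar> + 1"

lemma lip_const_pos: "lip_const a b > 0"
  by (simp add: lip_const_def add_nonneg_pos)

lemma pwl_lipschitz: "\<bar>pwl a b x - pwl a b y\<bar> \<le> lip_const a b * \<bar>x - y\<bar>"
proof -
  obtain k where k: "0 \<le> k" "k \<le> \<bar>x - y\<bar>"
    and e: "\<bar>pwl a b x - pwl a b y\<bar> = \<bar>b * (\<bar>x - y\<bar> - k) + a * k\<bar>"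
    by (rule pwl_difference)
  have "\<bar>b * (\<bar>x - y\<bar> - k) + a * k\<bar> \<le> \<bar>b\<bar> * (\<bar>x - y\<bar> - k) + \<bar>a\<bar> * k"
    using k by (intro order_trans[OF abs_triangle_ineq]) (simp add: abs_mult)
  also have "\<dots> \<le> \<bar>b\<bar> * \<bar>x - y\<bar> + \<bar>a\<bar> * \<bar>x - y\<bar>"
    using k by (intro add_mono mult_left_mono) auto
  also have "\<dots> \<le> lip_const a b * \<bar>x - y\<bar>" by (simp add: lip_const_def algebra_simps)
  finally show ?thesis using e by simp
qed

lemma pwl_minus: "pwl a b (- x) = - pwl a b x"
  by (auto simp: pwl_def algebra_simps)

lemma pwl_inner: "\<bar>x\<bar> \<le> 1 \<Longrightarrow> pwl a b x = b * x"
proof -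
  assume "\<bar>x\<bar> \<le> 1"
  then consider "x = -1" | "x = 1" | "-1 < x" "x < 1" by linarith
  then show ?thesis by cases (auto simp: pwl_def)
qed

lemma pwl_right: "1 \<le> x \<Longrightarrow> pwl a b x = a * x + (b - a)"
  by (auto simp: pwl_def)

lemma pwl_left: "x \<le> -1 \<Longrightarrow> pwl a b x = a * x - (b - a)"
  by (auto simp: pwl_def)

lemma solution_exists: "\<exists>\<phi>. solution a b \<mu> \<phi> \<and> \<phi> s = x"
proof -
  have "continuous_on UNIV (\<lambda>t. \<mu> * sin t)" by (intro continuous_intros)
  moreover have "\<bar>\<mu> * sin t\<bar> \<le> \<bar>\<mu>\<bar>" for t by (simp add: abs_mult mult_left_le)
  ultimately show ?thesis
    unfolding solution_def
    using lipschitz_ivp_solvable[OF lip_const_pos pwl_lipschitz, of "\<lambda>t. \<mu> * sin t" "\<bar>\<mu>\<bar>" s x] by blast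
qed

lemma solution_DERIV:
  "solution a b \<mu> \<phi> \<Longrightarrow> (\<phi> has_real_derivative pwl a b (\<phi> t) + \<mu> * sin t) (at t)"
  by (simp add: solution_def)

text \<open>The squared difference is differentiable, and its derivative is at most
  \<open>2 * L\<close> times itself in absolute value. Weighting it by
  \<open>exp (2 * L * t)\<close> makes it nondecreasing, by \<open>exp (- 2 * L * t)\<close>
  nonincreasing; these give the backward and the forward estimate.\<close>

lemma solution_gronwall:
  assumes "solution a b \<mu> \<phi>" "solution a b \<mu> \<psi>"
  shows "\<bar>\<phi> t - \<psi> t\<bar> \<le> exp (lip_const a b * \<bar>t - s\<bar>) * \<bar>\<phi> s - \<psi> s\<bar>"
proof -
  define L where "L = lip_const a b"
  define e where "e t = \<phi> t - \<psi> t" for t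
  define c where "c t = pwl a b (\<phi> t) - pwl a b (\<psi> t)" for t
  have e: "(e has_real_derivative c t) (at t)" for t
    unfolding e_def c_def by (auto intro!: derivative_eq_intros solution_DERIV assms)
  have c: "\<bar>c t * e t\<bar> \<le> L * (e t)\<^sup>2" for t
    using mult_right_mono[OF pwl_lipschitz[of a b "\<phi> t" "\<psi> t"], of "\<bar>e t\<bar>"]
    by (simp add: c_def e_def L_def abs_mult power2_eq_square mult_ac)
  have m: "mono (\<lambda>t. \<sigma> * ((e t)\<^sup>2 * exp (\<sigma> * (2 * L) * t)))" if \<sigma>: "\<bar>\<sigma>\<bar> = 1" for \<sigma>
  proof (rule mono_of_DERIV_nonneg)
    fix t
    show "((\<lambda>t. \<sigma> * ((e t)\<^sup>2 * exp (\<sigma> * (2 * L) * t))) has_real_derivative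
      2 * exp (\<sigma> * (2 * L) * t) * (L * (e t)\<^sup>2 + \<sigma> * (c t * e t))) (at t)"
      using \<sigma> by (auto intro!: derivative_eq_intros e simp: abs_if algebra_simps split: if_splits)
    show "0 \<le> 2 * exp (\<sigma> * (2 * L) * t) * (L * (e t)\<^sup>2 + \<sigma> * (c t * e t))"
      using c[of t] \<sigma> by (intro mult_nonneg_nonneg) (auto simp: abs_if split: if_splits)
  qed
  have sq: "(e t)\<^sup>2 \<le> (exp (L * \<bar>t - s\<bar>) * \<bar>e s\<bar>)\<^sup>2"
  proof (cases "s \<le> t")
    case True
    from monoD[OF m[of "-1"] True]
    have "(e t)\<^sup>2 * exp (- (2 * L) * t) \<le> (e s)\<^sup>2 * exp (- (2 * L) * s)" by simp
    then have "(e t)\<^sup>2 * exp (- (2 * L) * t) * exp (2 * L * t) \<le> (e s)\<^sup>2 * exp (- (2 * L) * s) * exp (2 * L * t)"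
      by (rule mult_right_mono) simp
    with True show ?thesis
      by (simp add: power_mult_distrib mult_exp_exp exp_minus field_simps exp_diff flip: exp_double exp_of_nat_mult)
  next
    case False
    then have "t \<le> s" by simp
    from monoD[OF m[of "1"] this]
    have "(e t)\<^sup>2 * exp (2 * L * t) \<le> (e s)\<^sup>2 * exp (2 * L * s)" by simp
    then have "(e t)\<^sup>2 * exp (2 * L * t) * exp (- (2 * L) * t) \<le> (e s)\<^sup>2 * exp (2 * L * s) * exp (- (2 * L) * t)"
      by (rule mult_right_mono) simp
    with False show ?thesis
      by (simp add: power_mult_distrib mult_exp_exp exp_minus field_simps exp_diff flip: exp_double exp_of_nat_mult)
  qed
  then have "\<bar>e t\<bar> \<le> exp (L * \<bar>t - s\<bar>) * \<bar>e s\<bar>"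
    using abs_le_square_iff[of "e t" "exp (L * \<bar>t - s\<bar>) * \<bar>e s\<bar>"] by (simp add: abs_mult)
  then show ?thesis by (simp add: e_def L_def)
qed

lemma solution_unique:
  assumes "solution a b \<mu> \<phi>" "solution a b \<mu> \<psi>" "\<phi> s = \<psi> s"
  shows "\<phi> = \<psi>"
proof
  show "\<phi> t = \<psi> t" for t using solution_gronwall[OF assms(1,2), of t s] assms(3) by simp
qed

text \<open>Uniqueness replaces the \<open>THE\<close> in \<open>u\<close> by any solution at hand,
  so later arguments can deal with solutions directly.\<close>

lemma u_eq:
  assumes "solution a b \<mu> \<phi>" "\<phi> s = x"
  shows "u a b \<mu> t s x = \<phi> t"
proof -
  have "(THE \<psi>. solution a b \<mu> \<psi> \<and> \<psi> s = x) = \<phi>"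
    using assms solution_unique by (intro the_equality) blast+
  then show ?thesis by (simp add: u_def)
qed

lemma solution_continuous: "solution a b \<mu> \<phi> \<Longrightarrow> continuous_on S \<phi>"
  by (rule DERIV_continuous_on[where D = "\<lambda>t. pwl a b (\<phi> t) + \<mu> * sin t"]) (rule has_field_derivative_at_within[OF solution_DERIV])

text \<open>Solutions of a scalar equation do not cross: by the intermediate value theorem a change
  of order gives a meeting time, and uniqueness then makes the two equal.\<close>

lemma solution_less:
  assumes "solution a b \<mu> \<phi>" "solution a b \<mu> \<psi>" "\<phi> s < \<psi> s"
  shows "\<phi> t < \<psi> t"
proof (rule ccontr)
  assume n: "\<not> \<phi> t < \<psi> t"
  have "continuous_on UNIV (\<lambda>t. \<psi> t - \<phi> t)"
    using assms by (intro continuous_intros solution_continuous)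
  then have conn: "connected (range (\<lambda>t. \<psi> t - \<phi> t))"
    by (rule connected_continuous_image) simp
  have "0 \<in> range (\<lambda>t. \<psi> t - \<phi> t)"
    by (rule connectedD_interval[OF conn rangeI[of _ t] rangeI[of _ s]]) (use n assms(3) in simp_all)
  then obtain r where "0 = \<psi> r - \<phi> r" by (rule imageE)
  then have "\<phi> = \<psi>" using solution_unique[OF assms(1,2), of r] by simp
  then show False using assms(3) by simp
qed

lemma solution_shift:
  assumes "solution a b \<mu> \<phi>"
  shows "solution a b \<mu> (\<lambda>t. \<phi> (t + 2 * pi))"
  unfolding solution_def
proof
  fix t
  show "((\<lambda>t. \<phi> (t + 2 * pi)) has_real_derivative pwl a b (\<phi> (t + 2 * pi)) + \<mu> * sin t) (at t)"
    using solution_DERIV[OF assms, of "t + 2 * pi"] by (simp add: DERIV_shift)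
qed

text \<open>Oddness of \<open>pwl\<close> combines with the sign change of the forcing after half a
  period.\<close>

lemma solution_reflect:
  assumes "solution a b \<mu> \<phi>"
  shows "solution a b \<mu> (\<lambda>t. - \<phi> (t + pi))"
  unfolding solution_def
proof
  fix t
  have "((\<lambda>t. \<phi> (t + pi)) has_real_derivative pwl a b (\<phi> (t + pi)) - \<mu> * sin t) (at t)"
    using solution_DERIV[OF assms, of "t + pi"] by (simp add: DERIV_shift)
  then show "((\<lambda>t. - \<phi> (t + pi)) has_real_derivative pwl a b (- \<phi> (t + pi)) + \<mu> * sin t) (at t)"
    by (auto intro!: derivative_eq_intros simp: pwl_minus)
qed

lemma poincare_eq: "solution a b \<mu> \<phi> \<Longrightarrow> poincare a b \<mu> (\<phi> 0) = \<phi> (2 * pi)"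
  by (simp add: poincare_def u_eq)

lemma poincare_eq_step:
  assumes "solution a b \<mu> \<phi>"
  shows "\<phi> (2 * pi * real (Suc n)) = poincare a b \<mu> (\<phi> (2 * pi * real n))"
proof -
  have "solution a b \<mu> (\<lambda>t. \<phi> (t + 2 * pi * real n))"
  proof (induction n)
    case (Suc n)
    from solution_shift[OF this] show ?case by (simp add: algebra_simps)
  qed (use assms in simp)
  from poincare_eq[OF this] show ?thesis by (simp add: algebra_simps)
qed

section \<open>The derivative of the Poincare map\<close>

lemma solution_ln_diff_DERIV:
  assumes "solution a b \<mu> \<phi>" "solution a b \<mu> \<psi>" "\<phi> t < \<psi> t"
  shows "((\<lambda>t. ln (\<psi> t - \<phi> t)) has_real_derivative
           (pwl a b (\<psi> t) - pwl a b (\<phi> t)) / (\<psi> t - \<phi> t)) (at t)"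
  using assms(3)
  by (auto intro!: derivative_eq_intros solution_DERIV[OF assms(1)] solution_DERIV[OF assms(2)]
      simp: field_simps)

text \<open>Dividing the gap by its initial value makes it positive on whichever side
  \<open>\<psi>\<close> starts and equal to 1 at time 0, so its logarithm is the integral of the
  chord slopes of \<open>pwl\<close>.\<close>

lemma solution_ratio:
  assumes \<phi>: "solution a b \<mu> \<phi>" and \<psi>: "solution a b \<mu> \<psi>" and ne: "\<psi> 0 \<noteq> \<phi> 0" and T: "0 \<le> T"
  shows "(\<psi> T - \<phi> T) / (\<psi> 0 - \<phi> 0) > 0"
    and "((\<lambda>t. (pwl a b (\<psi> t) - pwl a b (\<phi> t)) / (\<psi> t - \<phi> t)) has_integral
           ln ((\<psi> T - \<phi> T) / (\<psi> 0 - \<phi> 0))) {0..T}"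
proof -
  define h where "h t = (\<psi> t - \<phi> t) / (\<psi> 0 - \<phi> 0)" for t
  have h: "h t > 0" for t
  proof (cases "\<phi> 0 < \<psi> 0")
    case True
    with solution_less[OF \<phi> \<psi> True, of t] show ?thesis by (simp add: h_def)
  next
    case False
    with ne have *: "\<psi> 0 < \<phi> 0" by simp
    with solution_less[OF \<psi> \<phi> *, of t] show ?thesis by (simp add: h_def divide_neg_neg)
  qed
  then show "(\<psi> T - \<phi> T) / (\<psi> 0 - \<phi> 0) > 0" by (simp add: h_def)
  have "((\<lambda>t. ln (h t)) has_real_derivative (pwl a b (\<psi> t) - pwl a b (\<phi> t)) / (\<psi> t - \<phi> t)) (at t)" for t
  proof -
    have "(h has_real_derivative (pwl a b (\<psi> t) - pwl a b (\<phi> t)) / (\<psi> 0 - \<phi> 0)) (at t)"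
      unfolding h_def
      by (intro DERIV_cdivide) (auto intro!: derivative_eq_intros solution_DERIV[OF \<phi>] solution_DERIV[OF \<psi>])
    from DERIV_chain2[OF DERIV_ln_divide[OF h[of t]] this] ne h[of t]
    show ?thesis by (auto simp: h_def)
  qed
  then have "((\<lambda>t. (pwl a b (\<psi> t) - pwl a b (\<phi> t)) / (\<psi> t - \<phi> t)) has_integral (ln (h T) - ln (h 0))) {0..T}"
    using T by (intro fundamental_theorem_of_calculus)
      (auto simp: has_real_derivative_iff_has_vector_derivative intro: has_vector_derivative_at_within)
  then show "((\<lambda>t. (pwl a b (\<psi> t) - pwl a b (\<phi> t)) / (\<psi> t - \<phi> t)) has_integral
           ln ((\<psi> T - \<phi> T) / (\<psi> 0 - \<phi> 0))) {0..T}"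
    using ne by (simp add: h_def)
qed

lemma negligible_of_countable:
  fixes N :: "real set"
  assumes "countable N" shows "negligible N"
  using negligible_countable_Union[of "(\<lambda>x. {x}) ` N"] assms by auto

text \<open>The difference quotients of the Poincare map are exponentials of integrals of difference
  quotients of \<open>pwl\<close> along the orbit. Dominated convergence makes a null set of touching times
  with the lines \<open>x = \<plusminus>1\<close> harmless.\<close>

lemma poincare_DERIV:
  assumes \<phi>: "solution a b \<mu> \<phi>" and N: "countable N"
    and slope: "\<And>t. t \<notin> N \<Longrightarrow> (pwl a b has_real_derivative s) (at (\<phi> t))"
  shows "(poincare a b \<mu> has_real_derivative exp (2 * pi * s)) (at (\<phi> 0))"
  unfolding has_field_derivative_iff tendsto_at_iff_sequentially comp_def
proof (intro allI impI)
  fix X assume "\<forall>i. X i \<in> UNIV - {\<phi> 0}" and X0: "X \<longlonglongrightarrow> \<phi> 0"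
  then have X: "X i \<noteq> \<phi> 0" for i by auto
  have "\<exists>\<Psi>. \<forall>i. solution a b \<mu> (\<Psi> i) \<and> \<Psi> i 0 = X i"
    using solution_exists by (intro choice allI)
  then obtain \<Psi> where \<Psi>: "\<And>i. solution a b \<mu> (\<Psi> i)" and \<Psi>0: "\<And>i. \<Psi> i 0 = X i" by blast
  define c where "c i t = (pwl a b (\<Psi> i t) - pwl a b (\<phi> t)) / (\<Psi> i t - \<phi> t)" for i t
  define r where "r i = (\<Psi> i (2 * pi) - \<phi> (2 * pi)) / (\<Psi> i 0 - \<phi> 0)" for i
  have r: "r i > 0" and c: "(c i has_integral ln (r i)) {0..2 * pi}" for i
    unfolding r_def c_def using solution_ratio[OF \<phi> \<Psi>, of i "2 * pi"] X \<Psi>0 by auto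
  \<comment> \<open>Off \<open>N\<close> the integrands converge at every time; since
    \<open>N\<close> is null, the integrals are unchanged.\<close>
  define S where "S = {0..2 * pi} - N"
  have S: "(g has_integral y) S \<longleftrightarrow> (g has_integral y) {0..2 * pi}" for g :: "real \<Rightarrow> real" and y
    unfolding S_def
    by (rule has_integral_spike_set_eq; rule negligible_subset[OF negligible_of_countable[OF N]]) auto
  have ne: "\<Psi> i t \<noteq> \<phi> t" for i t
    using solution_unique[OF \<Psi> \<phi>, of i t] X[of i] \<Psi>0[of i] by metis
  have "(\<lambda>i. integral S (c i)) \<longlonglongrightarrow> integral S (\<lambda>_. s)"
  proof (rule dominated_convergence(2))
    show "c i integrable_on S" for i using c S by blast
    show "(\<lambda>_. lip_const a b) integrable_on S"
      using S has_integral_const_real by blast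
    show "norm (c i t) \<le> lip_const a b" for i t
      using pwl_lipschitz[of a b "\<Psi> i t" "\<phi> t"] ne[of i t] by (simp add: c_def pos_divide_le_eq)
    fix t assume "t \<in> S"
    then have "((\<lambda>y. (pwl a b y - pwl a b (\<phi> t)) / (y - \<phi> t)) \<longlongrightarrow> s) (at (\<phi> t))"
      using slope unfolding S_def has_field_derivative_iff by blast
    moreover have "filterlim (\<lambda>i. \<Psi> i t) (at (\<phi> t)) sequentially"
    proof (rule filterlim_atI)
      \<comment> \<open>Continuous dependence on the initial value at the fixed time
        \<open>t\<close>, by the Gronwall estimate.\<close>
      have "(\<lambda>i. exp (lip_const a b * \<bar>t - 0\<bar>) * \<bar>X i - \<phi> 0\<bar>) \<longlonglongrightarrow> exp (lip_const a b * \<bar>t - 0\<bar>) * \<bar>\<phi> 0 - \<phi> 0\<bar>"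
        by (intro tendsto_intros X0)
      then have "(\<lambda>i. exp (lip_const a b * \<bar>t - 0\<bar>) * \<bar>X i - \<phi> 0\<bar>) \<longlonglongrightarrow> 0" by simp
      then have "(\<lambda>i. \<Psi> i t - \<phi> t) \<longlonglongrightarrow> 0"
        by (rule Lim_null_comparison[rotated])
          (use solution_gronwall[OF \<Psi> \<phi>, of _ t 0] \<Psi>0 in auto)
      then show "(\<lambda>i. \<Psi> i t) \<longlonglongrightarrow> \<phi> t" using LIM_zero_iff by blast
      show "\<forall>\<^sub>F i in sequentially. \<Psi> i t \<noteq> \<phi> t" using ne by simp
    qed
    ultimately show "(\<lambda>i. c i t) \<longlonglongrightarrow> s" unfolding c_def by (rule filterlim_compose)
  qed
  moreover have "integral S (c i) = ln (r i)" for i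
    using c S by (intro integral_unique) blast
  moreover have "((\<lambda>_. s) has_integral (2 * pi * s)) S"
    using S has_integral_const_real[of s 0 "2 * pi"] by simp
  ultimately have "(\<lambda>i. ln (r i)) \<longlonglongrightarrow> 2 * pi * s" by (simp add: integral_unique)
  from tendsto_exp[OF this] have "r \<longlonglongrightarrow> exp (2 * pi * s)" using r by simp
  moreover have "(poincare a b \<mu> (X i) - poincare a b \<mu> (\<phi> 0)) / (X i - \<phi> 0) = r i" for i
    using poincare_eq[OF \<Psi>, of i] poincare_eq[OF \<phi>] by (simp add: r_def \<Psi>0)
  ultimately show "(\<lambda>i. (poincare a b \<mu> (X i) - poincare a b \<mu> (\<phi> 0)) / (X i - \<phi> 0)) \<longlonglongrightarrow> exp (2 * pi * s)"
    by simp
qed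

section \<open>Isolation and stability of periodic solutions from the derivative of the Poincare
  map\<close>

lemma periodic_solutionD:
  assumes "periodic_solution a b \<mu> \<phi>"
  shows "solution a b \<mu> \<phi>" "\<phi> (t + 2 * pi) = \<phi> t" "\<phi> (2 * pi * real n) = \<phi> 0"
    "poincare a b \<mu> (\<phi> 0) = \<phi> 0"
proof -
  show 1: "solution a b \<mu> \<phi>" and 2: "\<phi> (t + 2 * pi) = \<phi> t" for t
    using assms by (auto simp: periodic_solution_def)
  show "\<phi> (2 * pi * real n) = \<phi> 0"
  proof (induction n)
    case (Suc n)
    with 2[of "2 * pi * real n"] show ?case by (simp add: algebra_simps)
  qed simp
  show "poincare a b \<mu> (\<phi> 0) = \<phi> 0" using poincare_eq[OF 1] 2[of 0] by simp
qed

text \<open>Another fixed point would make the difference quotient of the Poincare map equal to 1,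
  which a limit \<open>D \<noteq> 1\<close> forbids nearby.\<close>

lemma limit_cycle_of_DERIV_ne_1:
  assumes \<phi>: "periodic_solution a b \<mu> \<phi>"
    and D: "(poincare a b \<mu> has_real_derivative D) (at (\<phi> 0))" "D \<noteq> 1"
  shows "limit_cycle a b \<mu> \<phi>"
proof -
  have "((\<lambda>y. (poincare a b \<mu> y - \<phi> 0) / (y - \<phi> 0)) \<longlongrightarrow> D) (at (\<phi> 0))"
    using D(1) periodic_solutionD(4)[OF \<phi>] by (simp add: has_field_derivative_iff)
  then have "\<forall>\<^sub>F y in at (\<phi> 0). (poincare a b \<mu> y - \<phi> 0) / (y - \<phi> 0) \<noteq> 1"
    using D(2) by (rule tendsto_imp_eventually_ne)
  then obtain e where e: "e > 0"
    "\<And>y. y \<noteq> \<phi> 0 \<Longrightarrow> dist y (\<phi> 0) < e \<Longrightarrow> (poincare a b \<mu> y - \<phi> 0) / (y - \<phi> 0) \<noteq> 1"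
    unfolding eventually_at by auto
  have "y = \<phi> 0" if "displacement a b \<mu> y = 0" "dist (\<phi> 0) y < e" for y
    using e(2)[of y] that by (auto simp: displacement_def dist_commute)
  then show ?thesis
    using \<phi> e(1) periodic_solutionD(4)[OF \<phi>]
    by (auto simp: limit_cycle_def isolated_in_dist_Ex_iff displacement_def)
qed

text \<open>Near the fixed point the Poincare map contracts by a factor \<open>k < 1\<close>, so
  deviations at multiples of \<open>2 * pi\<close> decay geometrically. The Gronwall estimate over
  at most one period controls the times between, and a further one carries an arbitrary initial time
  to 0.\<close>

lemma asymptotically_stable_of_DERIV_less_1:
  assumes \<phi>: "periodic_solution a b \<mu> \<phi>"
    and D: "(poincare a b \<mu> has_real_derivative D) (at (\<phi> 0))" "\<bar>D\<bar> < 1"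
  shows "asymptotically_stable a b \<mu> \<phi>"
proof -
  note sol = periodic_solutionD(1)[OF \<phi>]
  define k where "k = (\<bar>D\<bar> + 1) / 2"
  have k: "\<bar>D\<bar> < k" "0 < k" "k < 1" using D(2) by (auto simp: k_def)
  have "((\<lambda>y. (poincare a b \<mu> y - \<phi> 0) / (y - \<phi> 0)) \<longlongrightarrow> D) (at (\<phi> 0))"
    using D(1) periodic_solutionD(4)[OF \<phi>] by (simp add: has_field_derivative_iff)
  then have "\<forall>\<^sub>F y in at (\<phi> 0). \<bar>(poincare a b \<mu> y - \<phi> 0) / (y - \<phi> 0)\<bar> < k"
    using k(1) tendsto_rabs order_tendstoD(2) by blast
  then obtain d where d: "d > 0"
    "\<And>y. y \<noteq> \<phi> 0 \<Longrightarrow> dist y (\<phi> 0) < d \<Longrightarrow> \<bar>(poincare a b \<mu> y - \<phi> 0) / (y - \<phi> 0)\<bar> < k"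
    unfolding eventually_at by auto
  have P: "\<bar>poincare a b \<mu> y - \<phi> 0\<bar> \<le> k * \<bar>y - \<phi> 0\<bar>" if "\<bar>y - \<phi> 0\<bar> < d" for y
    using d(2)[of y] that periodic_solutionD(4)[OF \<phi>]
    by (cases "y = \<phi> 0") (auto simp: dist_real_def pos_divide_less_eq)
  define L where "L = lip_const a b"
  have L: "L > 0" by (simp add: L_def lip_const_pos)
  define C where "C = exp (L * (2 * pi))"
  have C: "C \<ge> 1" using L by (simp add: C_def)
  have iter: "\<bar>\<psi> (2 * pi * real n) - \<phi> 0\<bar> \<le> k ^ n * \<bar>\<psi> 0 - \<phi> 0\<bar>"
    if \<psi>: "solution a b \<mu> \<psi>" "\<bar>\<psi> 0 - \<phi> 0\<bar> < d" for \<psi> n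
  proof (induction n)
    case (Suc n)
    have "k ^ n * \<bar>\<psi> 0 - \<phi> 0\<bar> \<le> \<bar>\<psi> 0 - \<phi> 0\<bar>"
      using k by (intro mult_left_le_one_le) (auto simp: power_le_one)
    with Suc \<psi>(2) have "\<bar>\<psi> (2 * pi * real n) - \<phi> 0\<bar> < d" by linarith
    from P[OF this] Suc k(2) show ?case
      unfolding poincare_eq_step[OF \<psi>(1)] by (simp add: order_trans[OF _ mult_left_mono] mult.assoc)
  qed simp
  have decay: "\<bar>\<psi> t - \<phi> t\<bar> \<le> C * (k ^ nat \<lfloor>t / (2 * pi)\<rfloor> * \<bar>\<psi> 0 - \<phi> 0\<bar>)"
    if \<psi>: "solution a b \<mu> \<psi>" "\<bar>\<psi> 0 - \<phi> 0\<bar> < d" and t: "0 \<le> t" for \<psi> t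
  proof -
    define n where "n = nat \<lfloor>t / (2 * pi)\<rfloor>"
    have n: "2 * pi * real n \<le> t" "t \<le> 2 * pi * real n + 2 * pi"
    proof -
      have "real n = of_int \<lfloor>t / (2 * pi)\<rfloor>" using t by (simp add: n_def)
      then have "real n \<le> t / (2 * pi)" "t / (2 * pi) \<le> real n + 1" by linarith+
      then show "2 * pi * real n \<le> t" "t \<le> 2 * pi * real n + 2 * pi"
        by (simp_all add: field_simps)
    qed
    have "\<bar>\<psi> t - \<phi> t\<bar> \<le> exp (L * \<bar>t - 2 * pi * real n\<bar>) * \<bar>\<psi> (2 * pi * real n) - \<phi> (2 * pi * real n)\<bar>"
      unfolding L_def by (rule solution_gronwall[OF \<psi>(1) sol])
    also have "\<dots> \<le> C * (k ^ n * \<bar>\<psi> 0 - \<phi> 0\<bar>)"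
      unfolding periodic_solutionD(3)[OF \<phi>] C_def
      using n L by (intro mult_mono iter \<psi>) auto
    finally show ?thesis by (simp add: n_def)
  qed
  define E where "E s = exp (L * \<bar>s\<bar>)" for s
  have E: "E s > 0" for s by (simp add: E_def)
  have backwards: "\<bar>\<psi> 0 - \<phi> 0\<bar> \<le> E s * \<bar>\<psi> s - \<phi> s\<bar>" if "solution a b \<mu> \<psi>" for \<psi> s
    using solution_gronwall[OF that sol, of 0 s] by (simp add: E_def L_def)
  have start: "\<exists>\<psi>. solution a b \<mu> \<psi> \<and> (\<forall>t. u a b \<mu> t s x = \<psi> t) \<and> \<psi> s = x" for s x
    using solution_exists u_eq by metis
  have "stable a b \<mu> \<phi>"
    unfolding stable_def
  proof (intro allI impI)
    fix s \<epsilon> :: real assume \<epsilon>: "\<epsilon> > 0"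
    \<comment> \<open>Division by \<open>E s\<close> pays for moving the deviation from time
      \<open>s\<close> to time 0; there \<open>d\<close> keeps it where the map contracts, and
      \<open>\<epsilon> / C\<close> allows for the growth within one period.\<close>
    define \<delta> where "\<delta> = min d (\<epsilon> / C) / E s"
    have "\<delta> > 0" using \<epsilon> C d(1) E by (simp add: \<delta>_def)
    moreover have "\<bar>u a b \<mu> t s x - \<phi> t\<bar> < \<epsilon>" if x: "\<bar>x - \<phi> s\<bar> < \<delta>" and t: "s \<le> t" for x t
    proof -
      obtain \<psi> where \<psi>: "solution a b \<mu> \<psi>" "u a b \<mu> t s x = \<psi> t" "\<psi> s = x" using start by blast
      have "E s * \<bar>\<psi> s - \<phi> s\<bar> < min d (\<epsilon> / C)"
        using x E[of s] \<psi>(3) by (simp add: \<delta>_def field_simps)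
      then have *: "E s * \<bar>\<psi> s - \<phi> s\<bar> < d" "C * (E s * \<bar>\<psi> s - \<phi> s\<bar>) < \<epsilon>"
        using C by (auto simp: field_simps)
      have "\<bar>\<psi> t - \<phi> t\<bar> \<le> C * (E s * \<bar>\<psi> s - \<phi> s\<bar>)"
      proof (cases "0 \<le> t")
        case True
        have 0: "\<bar>\<psi> 0 - \<phi> 0\<bar> < d" using backwards[OF \<psi>(1), of s] *(1) by linarith
        have "\<bar>\<psi> t - \<phi> t\<bar> \<le> C * (k ^ nat \<lfloor>t / (2 * pi)\<rfloor> * \<bar>\<psi> 0 - \<phi> 0\<bar>)"
          by (rule decay[OF \<psi>(1) 0 True])
        also have "k ^ nat \<lfloor>t / (2 * pi)\<rfloor> * \<bar>\<psi> 0 - \<phi> 0\<bar> \<le> \<bar>\<psi> 0 - \<phi> 0\<bar>"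
          using k by (intro mult_left_le_one_le) (auto simp: power_le_one)
        also note backwards[OF \<psi>(1), of s]
        finally show ?thesis using C by simp
      next
        \<comment> \<open>Here \<open>s \<le> t < 0\<close>, so
          \<open>\<bar>t - s\<bar> \<le> \<bar>s\<bar>\<close> and the Gronwall estimate from
          \<open>s\<close> to \<open>t\<close> suffices.\<close>
        case False
        have "\<bar>\<psi> t - \<phi> t\<bar> \<le> exp (L * \<bar>t - s\<bar>) * \<bar>\<psi> s - \<phi> s\<bar>"
          unfolding L_def by (rule solution_gronwall[OF \<psi>(1) sol])
        also have "\<dots> \<le> E s * \<bar>\<psi> s - \<phi> s\<bar>"
          unfolding E_def using False t L
          by (intro mult_right_mono exp_le_cancel_iff[THEN iffD2] mult_left_mono) auto
        also have "\<dots> \<le> C * (E s * \<bar>\<psi> s - \<phi> s\<bar>)"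
          using C E[of s] mult_right_mono[of 1 C "E s * \<bar>\<psi> s - \<phi> s\<bar>"] by simp
        finally show ?thesis .
      qed
      with *(2) \<psi>(2) show ?thesis by simp
    qed
    ultimately show "\<exists>\<delta>>0. \<forall>x. \<bar>x - \<phi> s\<bar> < \<delta> \<longrightarrow> (\<forall>t\<ge>s. \<bar>u a b \<mu> t s x - \<phi> t\<bar> < \<epsilon>)" by blast
  qed
  moreover have "\<exists>\<delta>>0. \<forall>x. \<bar>x - \<phi> s\<bar> < \<delta> \<longrightarrow> ((\<lambda>t. u a b \<mu> t s x - \<phi> t) \<longlongrightarrow> 0) at_top" for s
  proof (intro exI conjI allI impI)
    show "d / E s > 0" using d(1) E by simp
    fix x assume x: "\<bar>x - \<phi> s\<bar> < d / E s"
    obtain \<psi> where \<psi>: "solution a b \<mu> \<psi>" "\<And>t. u a b \<mu> t s x = \<psi> t" "\<psi> s = x" using start by blast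
    have "E s * \<bar>\<psi> s - \<phi> s\<bar> < d"
      using x E[of s] \<psi>(3) by (simp add: field_simps)
    then have 0: "\<bar>\<psi> 0 - \<phi> 0\<bar> < d" using backwards[OF \<psi>(1), of s] by linarith
    have "filterlim (\<lambda>t. t / (2 * pi)) at_top at_top"
      using filterlim_tendsto_pos_mult_at_top[OF tendsto_const[of "1 / (2 * pi)"] _ filterlim_ident] by simp
    then have "filterlim (\<lambda>t. nat \<lfloor>t / (2 * pi)\<rfloor>) sequentially at_top"
      by (intro filterlim_compose[OF filterlim_nat_sequentially]
          filterlim_compose[OF filterlim_floor_sequentially])
    from filterlim_compose[OF LIMSEQ_power_zero this, of k] k
    have "((\<lambda>t. k ^ nat \<lfloor>t / (2 * pi)\<rfloor>) \<longlongrightarrow> 0) at_top" by simp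
    then have "((\<lambda>t. C * (k ^ nat \<lfloor>t / (2 * pi)\<rfloor> * \<bar>\<psi> 0 - \<phi> 0\<bar>)) \<longlongrightarrow> 0) at_top"
      by (intro tendsto_mult_right_zero tendsto_mult_left_zero)
    then show "((\<lambda>t. u a b \<mu> t s x - \<phi> t) \<longlongrightarrow> 0) at_top"
      unfolding \<psi>(2)
      by (rule Lim_null_comparison[rotated])
        (use decay[OF \<psi>(1) 0] in \<open>auto intro!: eventually_mono[OF eventually_ge_at_top[of 0]]\<close>)
  qed
  ultimately show ?thesis unfolding asymptotically_stable_def by blast
qed

text \<open>Deviations at multiples of the period grow by a factor \<open>k > 1\<close> while they
  are below \<open>d\<close>. Stability would keep a nonzero one below \<open>d\<close> forever,
  although the powers of \<open>k\<close> are unbounded.\<close>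

lemma unstable_of_DERIV_greater_1:
  assumes \<phi>: "periodic_solution a b \<mu> \<phi>"
    and D: "(poincare a b \<mu> has_real_derivative D) (at (\<phi> 0))" "1 < D"
  shows "unstable a b \<mu> \<phi>"
  unfolding unstable_def
proof
  assume st: "stable a b \<mu> \<phi>"
  define k where "k = (D + 1) / 2"
  have k: "k < D" "1 < k" using D(2) by (auto simp: k_def)
  have "((\<lambda>y. (poincare a b \<mu> y - \<phi> 0) / (y - \<phi> 0)) \<longlongrightarrow> D) (at (\<phi> 0))"
    using D(1) periodic_solutionD(4)[OF \<phi>] by (simp add: has_field_derivative_iff)
  then have "\<forall>\<^sub>F y in at (\<phi> 0). k < (poincare a b \<mu> y - \<phi> 0) / (y - \<phi> 0)"
    using k(1) order_tendstoD(1) by blast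
  then obtain d where d: "d > 0"
    "\<And>y. y \<noteq> \<phi> 0 \<Longrightarrow> dist y (\<phi> 0) < d \<Longrightarrow> k < (poincare a b \<mu> y - \<phi> 0) / (y - \<phi> 0)"
    unfolding eventually_at by auto
  have P: "k * \<bar>y - \<phi> 0\<bar> \<le> \<bar>poincare a b \<mu> y - \<phi> 0\<bar>" if "\<bar>y - \<phi> 0\<bar> < d" for y
  proof (cases "y = \<phi> 0")
    case False
    with d(2)[of y] that have "k < (poincare a b \<mu> y - \<phi> 0) / (y - \<phi> 0)" by (simp add: dist_real_def)
    also have "\<dots> \<le> \<bar>(poincare a b \<mu> y - \<phi> 0) / (y - \<phi> 0)\<bar>" by (rule abs_ge_self)
    finally show ?thesis using False by (simp add: field_simps)
  qed simp
  obtain \<delta> where \<delta>: "\<delta> > 0" "\<And>x t. \<bar>x - \<phi> 0\<bar> < \<delta> \<Longrightarrow> 0 \<le> t \<Longrightarrow> \<bar>u a b \<mu> t 0 x - \<phi> t\<bar> < d"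
    using st d(1) unfolding stable_def by meson
  obtain \<psi> where \<psi>: "solution a b \<mu> \<psi>" "\<psi> 0 = \<phi> 0 + \<delta> / 2" using solution_exists by blast
  have near: "\<bar>\<psi> (2 * pi * real n) - \<phi> 0\<bar> < d" for n
    using \<delta>(2)[of "\<psi> 0" "2 * pi * real n"] \<delta>(1) \<psi>(2) u_eq[OF \<psi>]
    by (simp add: periodic_solutionD(3)[OF \<phi>])
  have grow: "k ^ n * (\<delta> / 2) \<le> \<bar>\<psi> (2 * pi * real n) - \<phi> 0\<bar>" for n
  proof (induction n)
    case (Suc n)
    then have "k * (k ^ n * (\<delta> / 2)) \<le> k * \<bar>\<psi> (2 * pi * real n) - \<phi> 0\<bar>"
      using k by (intro mult_left_mono) auto
    also have "\<dots> \<le> \<bar>poincare a b \<mu> (\<psi> (2 * pi * real n)) - \<phi> 0\<bar>" by (rule P[OF near])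
    finally show ?case unfolding poincare_eq_step[OF \<psi>(1)] by (simp add: mult.assoc)
  qed (use \<psi>(2) \<delta>(1) in simp)
  obtain n where "2 * d / \<delta> < k ^ n" using real_arch_pow[OF k(2)] by blast
  then have "d < k ^ n * (\<delta> / 2)" using \<delta>(1) by (simp add: field_simps)
  with grow[of n] near[of n] show False by linarith
qed

section \<open>Periodic orbits of the linear pieces\<close>

text \<open>A \<open>2 * pi\<close>-periodic solution of the linear equation
  \<open>x' = s x + \<mu> sin t\<close>, the only one if \<open>s \<noteq> 0\<close>.\<close>

definition forced_response :: "real \<Rightarrow> real \<Rightarrow> real \<Rightarrow> real" where
  "forced_response s \<mu> t = - \<mu> * (s * sin t + cos t) / (s\<^sup>2 + 1)"

lemma square_plus_1_pos: "(s::real)\<^sup>2 + 1 > 0"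
  by (simp add: add_nonneg_pos)

lemma forced_response_DERIV:
  "(forced_response s \<mu> has_real_derivative s * forced_response s \<mu> t + \<mu> * sin t) (at t)"
proof -
  have "(forced_response s \<mu> has_real_derivative - \<mu> * (s * cos t - sin t) / (s\<^sup>2 + 1)) (at t)"
    unfolding forced_response_def
    by (intro DERIV_cdivide) (auto intro!: derivative_eq_intros simp: algebra_simps)
  moreover have "- \<mu> * (s * cos t - sin t) / (s\<^sup>2 + 1) = s * forced_response s \<mu> t + \<mu> * sin t"
    using square_plus_1_pos[of s] by (simp add: forced_response_def field_simps power2_eq_square)
  ultimately show ?thesis by simp
qed

lemma forced_response_periodic: "forced_response s \<mu> (t + 2 * pi) = forced_response s \<mu> t"
  by (simp add: forced_response_def)

lemma forced_response_antiperiodic: "forced_response s \<mu> (t + pi) = - forced_response s \<mu> t"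
proof -
  have "s * sin (t + pi) + cos (t + pi) = - (s * sin t + cos t)" by simp
  then show ?thesis
    unfolding forced_response_def by (simp only: mult_minus_right minus_divide_left)
qed

text \<open>The second bracket is the derivative of the first, so the identity yields both the
  amplitude and the vanishing of the derivative at extremal levels.\<close>

lemma sin_cos_combination_squares:
  "(s * sin t + cos t)\<^sup>2 + (s * cos t - sin t)\<^sup>2 = s\<^sup>2 + (1::real)"
  using sin_cos_squared_add[of t] by algebra

lemma abs_forced_response_le: "\<bar>forced_response s \<mu> t\<bar> \<le> \<bar>\<mu>\<bar> / sqrt (s\<^sup>2 + 1)"
proof -
  define r where "r = sqrt (s\<^sup>2 + 1)"
  have r: "r > 0" "s\<^sup>2 + 1 = r * r" using square_plus_1_pos[of s] by (auto simp: r_def)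
  have "r\<^sup>2 = s\<^sup>2 + 1" unfolding r(2) by (rule power2_eq_square)
  then have "(s * sin t + cos t)\<^sup>2 \<le> r\<^sup>2"
    using sin_cos_combination_squares[of s t] zero_le_power2[of "s * cos t - sin t"] by linarith
  then have le: "\<bar>s * sin t + cos t\<bar> \<le> r" using r(1) abs_le_square_iff[of _ r] by auto
  have "\<bar>forced_response s \<mu> t\<bar> = \<bar>\<mu>\<bar> * \<bar>s * sin t + cos t\<bar> / (r * r)"
    unfolding forced_response_def r(2) using r(1) by (simp add: abs_mult)
  also have "\<dots> \<le> \<bar>\<mu>\<bar> * r / (r * r)"
    using le r(1) by (intro divide_right_mono mult_left_mono) auto
  also have "\<dots> = \<bar>\<mu>\<bar> / r" using r(1) by simp
  finally show ?thesis unfolding r_def .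
qed

lemma forced_response_attains: "\<exists>t. forced_response s \<mu> t = \<bar>\<mu>\<bar> / sqrt (s\<^sup>2 + 1)"
proof -
  define r where "r = sqrt (s\<^sup>2 + 1)"
  have r: "r > 0" "s\<^sup>2 + 1 = r * r" using square_plus_1_pos[of s] by (auto simp: r_def)
  define \<sigma> :: real where "\<sigma> = (if \<mu> \<ge> 0 then 1 else -1)"
  have \<sigma>: "\<sigma> * \<sigma> = 1" "\<mu> * \<sigma> = \<bar>\<mu>\<bar>" by (auto simp: \<sigma>_def)
  \<comment> \<open>The point \<open>(cos t, sin t) = - \<sigma> (1, s) / r\<close> of the unit
    circle gives \<open>s * sin t + cos t\<close> its extreme value \<open>- \<sigma> * r\<close>;
    the sign \<open>\<sigma>\<close> selects the maximum of the response.\<close>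
  have "(- \<sigma> / r)\<^sup>2 + (- \<sigma> * s / r)\<^sup>2 = (\<sigma> * \<sigma>) * (s\<^sup>2 + 1) / (r * r)"
    using r(1) by (simp add: power2_eq_square field_simps)
  also have "\<dots> = 1" unfolding r(2) \<sigma>(1) using r(1) by simp
  finally obtain t where t: "- \<sigma> / r = cos t" "- \<sigma> * s / r = sin t"
    by (rule sincos_total_2pi)
  have "s * sin t + cos t = - \<sigma> * (s\<^sup>2 + 1) / r"
    unfolding t[symmetric] using r(1) by (simp add: power2_eq_square field_simps)
  also have "\<dots> = - \<sigma> * r" unfolding r(2) using r(1) by simp
  finally have "forced_response s \<mu> t = \<mu> * \<sigma> * r / (r * r)"
    unfolding forced_response_def r(2) by simp
  then show ?thesis unfolding \<sigma>(2) r_def[symmetric] using r(1) by (intro exI[of _ t]) simp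
qed

text \<open>The amplitude is a maximum that is attained, so the criterion is exact and includes
  tangency to the level \<open>R\<close>.\<close>

lemma forced_response_le_iff:
  "(\<forall>t. forced_response s \<mu> t \<le> R) \<longleftrightarrow> \<bar>\<mu>\<bar> \<le> R * sqrt (s\<^sup>2 + 1)"
proof -
  obtain t0 where t0: "forced_response s \<mu> t0 = \<bar>\<mu>\<bar> / sqrt (s\<^sup>2 + 1)"
    using forced_response_attains by blast
  have "forced_response s \<mu> t \<le> \<bar>\<mu>\<bar> / sqrt (s\<^sup>2 + 1)" for t
    using abs_forced_response_le by (rule abs_le_D1)
  then have "(\<forall>t. forced_response s \<mu> t \<le> R) \<longleftrightarrow> \<bar>\<mu>\<bar> / sqrt (s\<^sup>2 + 1) \<le> R"
    unfolding t0[symmetric] by (blast intro: order_trans)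
  then show ?thesis using square_plus_1_pos[of s] by (simp add: pos_divide_le_eq)
qed

text \<open>A shift by half a period turns lower bounds into upper bounds.\<close>

lemma forced_response_ge_iff:
  "(\<forall>t. - R \<le> forced_response s \<mu> t) \<longleftrightarrow> \<bar>\<mu>\<bar> \<le> R * sqrt (s\<^sup>2 + 1)"
proof -
  have "(\<forall>t. - R \<le> forced_response s \<mu> t) \<longleftrightarrow> (\<forall>t. forced_response s \<mu> t \<le> R)"
  proof (intro iffI allI)
    fix t assume "\<forall>t. - R \<le> forced_response s \<mu> t"
    then have "- R \<le> forced_response s \<mu> (t + pi)" by blast
    then show "forced_response s \<mu> t \<le> R" by (simp add: forced_response_antiperiodic)
  next
    fix t assume "\<forall>t. forced_response s \<mu> t \<le> R"
    then have "forced_response s \<mu> (t + pi) \<le> R" by blast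
    then show "- R \<le> forced_response s \<mu> t" by (simp add: forced_response_antiperiodic)
  qed
  then show ?thesis using forced_response_le_iff by simp
qed

lemma countable_sin_cos_eq: "countable {t::real. sin t = x \<and> cos t = y}"
proof (cases "\<exists>t::real. sin t = x \<and> cos t = y")
  case True
  then obtain t0 :: real where t0: "sin t0 = x" "cos t0 = y" by blast
  have "{t::real. sin t = x \<and> cos t = y} \<subseteq> range (\<lambda>n::int. t0 + 2 * pi * n)"
    using sin_cos_eq_iff[of _ t0] t0 by auto
  then show ?thesis by (rule countable_subset) simp
next
  case False
  then have empty: "{t::real. sin t = x \<and> cos t = y} = {}" by blast
  show ?thesis unfolding empty by simp
qed

text \<open>Such a level is extremal, so the derivative vanishes as well there, which determines
  both \<open>sin t\<close> and \<open>cos t\<close>.\<close>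

lemma countable_forced_response_eq:
  assumes R: "R \<noteq> 0" and \<mu>: "\<bar>\<mu>\<bar> \<le> \<bar>R\<bar> * sqrt (s\<^sup>2 + 1)"
  shows "countable {t. forced_response s \<mu> t = R}"
proof -
  have "{t. forced_response s \<mu> t = R} \<subseteq> {t. sin t = - s * R / \<mu> \<and> cos t = - R / \<mu>}"
  proof safe
    fix t assume R_eq: "R = forced_response s \<mu> t"
    let ?A = "s * sin t + cos t" and ?B = "s * cos t - sin t"
    have A: "R * (s\<^sup>2 + 1) = - \<mu> * ?A"
      using R_eq square_plus_1_pos[of s] by (simp add: forced_response_def field_simps)
    have \<mu>0: "\<mu> \<noteq> 0" using A R square_plus_1_pos[of s] by auto
    have "\<mu>\<^sup>2 \<le> (R * sqrt (s\<^sup>2 + 1))\<^sup>2"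
      using \<mu> abs_le_square_iff[of \<mu> "R * sqrt (s\<^sup>2 + 1)"] by (simp add: abs_mult)
    then have "\<mu>\<^sup>2 \<le> R\<^sup>2 * (s\<^sup>2 + 1)" by (simp add: power_mult_distrib)
    then have "\<mu>\<^sup>2 * (s\<^sup>2 + 1) \<le> R\<^sup>2 * (s\<^sup>2 + 1) * (s\<^sup>2 + 1)"
      by (rule mult_right_mono) simp
    also have "\<dots> = (R * (s\<^sup>2 + 1))\<^sup>2" by (simp add: power2_eq_square)
    also have "\<dots> = \<mu>\<^sup>2 * ?A\<^sup>2" unfolding A by (simp add: power_mult_distrib)
    \<comment> \<open>As the squares of \<open>?A\<close> and \<open>?B\<close> sum to
      \<open>s\<^sup>2 + 1\<close>, a level this high leaves no room for \<open>?B\<close>.\<close>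
    finally have "\<mu>\<^sup>2 * (?A\<^sup>2 + ?B\<^sup>2) \<le> \<mu>\<^sup>2 * ?A\<^sup>2"
      by (simp only: sin_cos_combination_squares)
    then have "\<mu>\<^sup>2 * ?B\<^sup>2 \<le> 0" by (simp only: distrib_left)
    then have B: "sin t = s * cos t"
      using \<mu>0 by (simp add: mult_le_0_iff)
    have "R * (s\<^sup>2 + 1) = - \<mu> * cos t * (s\<^sup>2 + 1)"
      unfolding A B by (simp add: power2_eq_square algebra_simps)
    then have R': "R = - \<mu> * cos t" using square_plus_1_pos[of s] by (metis less_irrefl mult_right_cancel)
    show "cos t = - forced_response s \<mu> t / \<mu>"
      using \<mu>0 R' R_eq by (simp add: field_simps)
    show "sin t = - s * forced_response s \<mu> t / \<mu>"
      using \<mu>0 R' R_eq B by (simp add: field_simps)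
  qed
  then show ?thesis by (rule countable_subset) (rule countable_sin_cos_eq)
qed

section \<open>Periodic solutions confined to one zone\<close>

text \<open>Such a function is a multiple of \<open>exp (s * t)\<close>, and one period multiplies
  it by \<open>exp (2 * pi * s) \<noteq> 1\<close>.\<close>

lemma periodic_exponential_zero:
  fixes e :: "real \<Rightarrow> real"
  assumes e: "\<And>t. (e has_real_derivative s * e t) (at t)" and p: "\<And>t. e (t + 2 * pi) = e t"
    and s: "s \<noteq> 0"
  shows "e t = 0"
proof -
  have "\<forall>t. ((\<lambda>t. e t * exp (- s * t)) has_real_derivative 0) (at t)"
    by (auto intro!: derivative_eq_intros e)
  from DERIV_isconst_all[OF this, of "t + 2 * pi" t]
  have "e t * (exp (- s * t) * exp (- s * (2 * pi))) = e t * exp (- s * t)"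
    unfolding p by (simp add: mult_exp_exp algebra_simps)
  then have "e t = 0 \<or> exp (- s * (2 * pi)) = exp 0" by auto
  then show ?thesis using s unfolding exp_inj_iff by simp
qed

text \<open>The periodic solution of \<open>x' = s x + k + \<mu> sin t\<close>; the three zones correspond to
  \<open>(s, k) = (a, a - b)\<close>, \<open>(b, 0)\<close> and \<open>(a, b - a)\<close>.\<close>

definition zone_orbit :: "real \<Rightarrow> real \<Rightarrow> real \<Rightarrow> real \<Rightarrow> real" where
  "zone_orbit s k \<mu> t = - k / s + forced_response s \<mu> t"

lemma periodic_solution_zone_orbit:
  assumes "s \<noteq> 0" "\<And>t. pwl a b (zone_orbit s k \<mu> t) = s * zone_orbit s k \<mu> t + k"
  shows "periodic_solution a b \<mu> (zone_orbit s k \<mu>)"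
proof -
  have "(zone_orbit s k \<mu> has_real_derivative s * zone_orbit s k \<mu> t + k + \<mu> * sin t) (at t)" for t
    unfolding zone_orbit_def [abs_def]
    using assms(1) by (auto intro!: derivative_eq_intros forced_response_DERIV simp: field_simps)
  then show ?thesis
    unfolding periodic_solution_def solution_def assms(2)
    by (simp add: zone_orbit_def forced_response_periodic)
qed

text \<open>The difference of the two is periodic and solves the homogeneous equation
  \<open>e' = s e\<close>. The sinusoid enters only as a solution of the linear equation; that it
  lies in the zone then follows from the equality.\<close>

lemma periodic_solution_eq_zone_orbit:
  assumes \<psi>: "periodic_solution a b \<mu> \<psi>" and s: "s \<noteq> 0"
    and zone: "\<And>t. pwl a b (\<psi> t) = s * \<psi> t + k"
  shows "\<psi> = zone_orbit s k \<mu>"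
proof
  fix t
  have "\<psi> t - zone_orbit s k \<mu> t = 0"
  proof (rule periodic_exponential_zero[OF _ _ s, where e = "\<lambda>t. \<psi> t - zone_orbit s k \<mu> t"])
    fix t
    have "((\<lambda>t. \<psi> t - zone_orbit s k \<mu> t) has_real_derivative
        (s * \<psi> t + k + \<mu> * sin t) - (s * forced_response s \<mu> t + \<mu> * sin t)) (at t)"
      unfolding zone_orbit_def
      using solution_DERIV[OF periodic_solutionD(1)[OF \<psi>], of t] unfolding zone
      by (auto intro!: derivative_eq_intros forced_response_DERIV)
    moreover have "(s * \<psi> t + k + \<mu> * sin t) - (s * forced_response s \<mu> t + \<mu> * sin t)
        = s * (\<psi> t - zone_orbit s k \<mu> t)"
      using s by (simp add: zone_orbit_def field_simps)
    ultimately show "((\<lambda>t. \<psi> t - zone_orbit s k \<mu> t) has_real_derivative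
        s * (\<psi> t - zone_orbit s k \<mu> t)) (at t)" by simp
    show "\<psi> (t + 2 * pi) - zone_orbit s k \<mu> (t + 2 * pi) = \<psi> t - zone_orbit s k \<mu> t"
      by (simp add: zone_orbit_def forced_response_periodic periodic_solutionD(2)[OF \<psi>])
  qed
  then show "\<psi> t = zone_orbit s k \<mu> t" by simp
qed

lemma pwl_DERIV_inner:
  assumes "\<bar>x\<bar> < 1" shows "(pwl a b has_real_derivative b) (at x)"
proof (rule has_field_derivative_transform_within_open)
  show "((\<lambda>x. b * x) has_real_derivative b) (at x)" by (auto intro!: derivative_eq_intros)
  show "open {-1<..<1::real}" "x \<in> {-1<..<1}" using assms by auto
qed (subst pwl_inner, auto)

lemma pwl_DERIV_right:
  assumes "1 < x" shows "(pwl a b has_real_derivative a) (at x)"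
proof (rule has_field_derivative_transform_within_open)
  show "((\<lambda>x. a * x + (b - a)) has_real_derivative a) (at x)" by (auto intro!: derivative_eq_intros)
  show "open {(1::real)<..}" "x \<in> {1<..}" using assms by auto
qed (simp add: pwl_right)

lemma pwl_DERIV_left:
  assumes "x < -1" shows "(pwl a b has_real_derivative a) (at x)"
proof (rule has_field_derivative_transform_within_open)
  show "((\<lambda>x. a * x - (b - a)) has_real_derivative a) (at x)" by (auto intro!: derivative_eq_intros)
  show "open {..<-1::real}" "x \<in> {..<-1}" using assms by auto
qed (simp add: pwl_left)

text \<open>One slope \<open>s\<close> at all but countably many times gives the multiplier
  \<open>exp (2 * pi * s)\<close>, so the sign of \<open>s\<close> decides stability.\<close>

lemma periodic_solution_in_zone:
  assumes \<phi>: "periodic_solution a b \<mu> \<phi>" and N: "countable N"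
    and slope: "\<And>t. t \<notin> N \<Longrightarrow> (pwl a b has_real_derivative s) (at (\<phi> t))" and s: "s \<noteq> 0"
  shows "limit_cycle a b \<mu> \<phi>" "hyperbolic a b \<mu> \<phi>"
    "s < 0 \<Longrightarrow> asymptotically_stable a b \<mu> \<phi>" "s > 0 \<Longrightarrow> unstable a b \<mu> \<phi>"
proof -
  note D = poincare_DERIV[OF periodic_solutionD(1)[OF \<phi>] N slope]
  have ne: "exp (2 * pi * s) \<noteq> 1" using s by simp
  show "limit_cycle a b \<mu> \<phi>" by (rule limit_cycle_of_DERIV_ne_1[OF \<phi> D ne])
  show "hyperbolic a b \<mu> \<phi>" unfolding hyperbolic_def using D ne by blast
  show "asymptotically_stable a b \<mu> \<phi>" if "s < 0"
  proof (rule asymptotically_stable_of_DERIV_less_1[OF \<phi> D])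
    have "2 * pi * s < 0" using that by (intro mult_pos_neg) auto
    then show "\<bar>exp (2 * pi * s)\<bar> < 1" unfolding abs_exp_cancel by simp
  qed
  show "unstable a b \<mu> \<phi>" if "s > 0"
  proof (rule unstable_of_DERIV_greater_1[OF \<phi> D])
    have "0 < 2 * pi * s" using that by (intro mult_pos_pos) auto
    then show "1 < exp (2 * pi * s)" by (simp only: one_less_exp_iff)
  qed
qed

text \<open>On \<open>x \<ge> -1\<close> the function \<open>pwl a b\<close> is concave if \<open>b > 0\<close> and convex if \<open>b < 0\<close>.\<close>

lemma pwl_slopes:
  assumes ab: "a * b < 0" and x: "\<bar>x\<bar> \<le> 1" and z: "1 \<le> z" and "x < y" "y < z"
  defines "\<Delta> \<equiv> (pwl a b y - pwl a b x) / (y - x) - (pwl a b z - pwl a b y) / (z - y)"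
  shows "0 \<le> b * \<Delta>" "x < 1 \<Longrightarrow> 1 < z \<Longrightarrow> 0 < b * \<Delta>"
proof -
  \<comment> \<open>The change of slope \<open>b - a\<close> has the sign of \<open>b\<close>, so
    its product with \<open>b\<close> is positive in both cases.\<close>
  have k: "b * b - a * b > 0" using ab by (smt (verit) zero_le_square)
  \<comment> \<open>At most one of the two chords runs across the corner at 1; the other has slope
    exactly \<open>b\<close> or \<open>a\<close>.\<close>
  consider "y \<le> 1" | "1 \<le> y" by linarith
  then have "0 \<le> b * \<Delta> \<and> (x < 1 \<and> 1 < z \<longrightarrow> 0 < b * \<Delta>)"
  proof cases
    case 1
    then have "pwl a b y = b * y" using x \<open>x < y\<close> by (intro pwl_inner) linarith
    then have "\<Delta> = b - (a * z + (b - a) - b * y) / (z - y)"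
      unfolding \<Delta>_def pwl_inner[OF x] pwl_right[OF z] using \<open>x < y\<close>
      by (simp flip: right_diff_distrib)
    then have "\<Delta> * (z - y) = b * (z - y) - (a * z + (b - a) - b * y)"
      using \<open>y < z\<close> by (simp only: left_diff_distrib) simp
    then have "b * \<Delta> * (z - y) = (b * b - a * b) * (z - 1)" by algebra
    then have "b * \<Delta> = (b * b - a * b) * (z - 1) / (z - y)"
      using \<open>y < z\<close> by (simp add: eq_divide_eq)
    then show ?thesis using k z \<open>y < z\<close> by simp
  next
    case 2
    then have "\<Delta> = (a * y + (b - a) - b * x) / (y - x) - a"
      unfolding \<Delta>_def pwl_inner[OF x] pwl_right[OF z] pwl_right[OF 2] using \<open>y < z\<close>
      by (simp flip: right_diff_distrib)
    then have "\<Delta> * (y - x) = a * y + (b - a) - b * x - a * (y - x)"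
      using \<open>x < y\<close> by (simp only: left_diff_distrib) simp
    then have "b * \<Delta> * (y - x) = (b * b - a * b) * (1 - x)" by algebra
    then have "b * \<Delta> = (b * b - a * b) * (1 - x) / (y - x)"
      using \<open>x < y\<close> by (simp add: eq_divide_eq)
    then show ?thesis using k x \<open>x < y\<close> by simp
  qed
  then show "0 \<le> b * \<Delta>" "x < 1 \<Longrightarrow> 1 < z \<Longrightarrow> 0 < b * \<Delta>" by auto
qed

text \<open>By \<open>pwl_slopes\<close> the periodic function \<open>b (ln (\<psi> - m) - ln (r - \<psi>))\<close> is nondecreasing,
  hence constant.\<close>

lemma no_periodic_solution_between:
  assumes ab: "a * b < 0"
    and m: "periodic_solution a b \<mu> m" "\<And>t. \<bar>m t\<bar> \<le> 1"
    and r: "periodic_solution a b \<mu> r" "\<And>t. 1 \<le> r t"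
    and \<psi>: "periodic_solution a b \<mu> \<psi>" "m 0 < \<psi> 0" "\<psi> 0 < r 0"
    and t1: "m t1 < 1" "1 < r t1"
  shows False
proof -
  note sol = m(1)[THEN periodic_solutionD(1)] r(1)[THEN periodic_solutionD(1)] \<psi>(1)[THEN periodic_solutionD(1)]
  have lt: "m t < \<psi> t" "\<psi> t < r t" for t
    using solution_less[OF sol(1,3) \<psi>(2)] solution_less[OF sol(3,2) \<psi>(3)] by auto
  define W where "W t = b * (ln (\<psi> t - m t) - ln (r t - \<psi> t))" for t
  define W' where "W' t = b * ((pwl a b (\<psi> t) - pwl a b (m t)) / (\<psi> t - m t)
      - (pwl a b (r t) - pwl a b (\<psi> t)) / (r t - \<psi> t))" for t
  have W: "(W has_real_derivative W' t) (at t)" for t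
    unfolding W_def [abs_def] W'_def
    by (intro DERIV_cmult DERIV_diff solution_ln_diff_DERIV[OF sol(1,3)] solution_ln_diff_DERIV[OF sol(3,2)] lt)
  have "mono W"
    by (rule mono_of_DERIV_nonneg[OF W]) (simp add: W'_def pwl_slopes(1)[OF ab m(2) r(2) lt])
  \<comment> \<open>Strict growth at one time contradicts periodicity: \<open>W\<close> would exceed
    \<open>W t1\<close> shortly after \<open>t1\<close> and could not return by
    \<open>t1 + 2 * pi\<close>.\<close>
  have "0 < W' t1"
    unfolding W'_def by (rule pwl_slopes(2)[OF ab m(2) r(2) lt t1])
  from DERIV_pos_inc_right[OF W this] obtain d
    where d: "d > 0" "\<And>h. 0 < h \<Longrightarrow> h < d \<Longrightarrow> W t1 < W (t1 + h)" by blast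
  have "W t1 < W (t1 + min (d / 2) (2 * pi))" using d(1) by (intro d(2)) auto
  also have "\<dots> \<le> W (t1 + 2 * pi)" by (intro monoD[OF \<open>mono W\<close>]) simp
  also have "\<dots> = W t1"
    using periodic_solutionD(2)[OF m(1)] periodic_solutionD(2)[OF r(1)] periodic_solutionD(2)[OF \<psi>(1)]
    by (simp add: W_def)
  finally show False by simp
qed

lemma periodic_solution_reflect:
  assumes "periodic_solution a b \<mu> \<phi>"
  shows "periodic_solution a b \<mu> (\<lambda>t. - \<phi> (t + pi))"
  unfolding periodic_solution_def
proof (intro conjI allI)
  show "solution a b \<mu> (\<lambda>t. - \<phi> (t + pi))"
    by (rule solution_reflect[OF periodic_solutionD(1)[OF assms]])
  show "- \<phi> (t + 2 * pi + pi) = - \<phi> (t + pi)" for t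
    using periodic_solutionD(2)[OF assms, of "t + pi"] by (simp add: algebra_simps)
qed

text \<open>The reflection exchanges the two outer orbits, \<open>k = a - b\<close> and
  \<open>k = b - a\<close>, and fixes the middle one, \<open>k = 0\<close>.\<close>

lemma zone_orbit_reflect: "- zone_orbit s k \<mu> (t + pi) = zone_orbit s (- k) \<mu> t"
  by (simp add: zone_orbit_def forced_response_antiperiodic)

section \<open>Zone conditions as bounds on \<mu>, and both directions of the equivalence\<close>

text \<open>The centre \<open>- (b - a) / a\<close> is \<open>1 - b / a\<close>, so
  \<open>- b / a > 0\<close> is the room the oscillation has above the line
  \<open>x = 1\<close>.\<close>

lemma located_in_right_iff:
  assumes "a * b < 0"
  shows "located_in (zone_orbit a (b - a) \<mu>) {1..} \<longleftrightarrow> \<bar>\<mu>\<bar> \<le> - b * sqrt (a\<^sup>2 + 1) / a"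
proof -
  have "located_in (zone_orbit a (b - a) \<mu>) {1..} \<longleftrightarrow> (\<forall>t. - (- b / a) \<le> forced_response a \<mu> t)"
    using assms by (auto simp: located_in_def zone_orbit_def diff_divide_distrib)
  then show ?thesis unfolding forced_response_ge_iff by simp
qed

lemma located_in_left_iff:
  assumes "a * b < 0"
  shows "located_in (zone_orbit a (a - b) \<mu>) {..-1} \<longleftrightarrow> \<bar>\<mu>\<bar> \<le> - b * sqrt (a\<^sup>2 + 1) / a"
proof -
  have "located_in (zone_orbit a (a - b) \<mu>) {..-1} \<longleftrightarrow> (\<forall>t. forced_response a \<mu> t \<le> - b / a)"
    using assms by (auto simp: located_in_def zone_orbit_def diff_divide_distrib) (smt (verit))+
  then show ?thesis unfolding forced_response_le_iff by simp
qed

lemma located_in_middle_iff: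
  "located_in (zone_orbit b 0 \<mu>) {-1..1} \<longleftrightarrow> \<bar>\<mu>\<bar> \<le> sqrt (b\<^sup>2 + 1)"
  using forced_response_le_iff[of b \<mu> 1] forced_response_ge_iff[of 1 b \<mu>]
  by (auto simp: located_in_def zone_orbit_def)

lemma periodic_solution_in_linearity_zone:
  assumes ab: "a * b < 0" and \<phi>: "periodic_solution a b \<mu> \<phi>"
  shows "located_in \<phi> {..-1} \<Longrightarrow> \<phi> = zone_orbit a (a - b) \<mu>"
    "located_in \<phi> {-1..1} \<Longrightarrow> \<phi> = zone_orbit b 0 \<mu>"
    "located_in \<phi> {1..} \<Longrightarrow> \<phi> = zone_orbit a (b - a) \<mu>"
proof -
  have s: "a \<noteq> 0" "b \<noteq> 0" using ab by auto
  show "\<phi> = zone_orbit a (a - b) \<mu>" if "located_in \<phi> {..-1}"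
    using that by (intro periodic_solution_eq_zone_orbit[OF \<phi> s(1)]) (simp add: located_in_def pwl_left)
  show "\<phi> = zone_orbit b 0 \<mu>" if "located_in \<phi> {-1..1}"
    using that by (intro periodic_solution_eq_zone_orbit[OF \<phi> s(2)])
      (simp add: located_in_def pwl_inner abs_le_iff minus_le_iff)
  show "\<phi> = zone_orbit a (b - a) \<mu>" if "located_in \<phi> {1..}"
    using that by (intro periodic_solution_eq_zone_orbit[OF \<phi> s(1)]) (simp add: located_in_def pwl_right)
qed

text \<open>Sufficiency. The three orbits are ordered at one time, hence at all times, since
  solutions do not cross. Their values at 0 split the line into four gaps, and each gap is shown to
  contain no further periodic solution.\<close>

lemma three_limit_cycles:
  assumes ab: "a * b < 0"
    and mu_outer: "\<bar>\<mu>\<bar> \<le> - b * sqrt (a\<^sup>2 + 1) / a" and mu_inner: "\<bar>\<mu>\<bar> \<le> sqrt (b\<^sup>2 + 1)"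
  defines "l \<equiv> zone_orbit a (a - b) \<mu>" and "m \<equiv> zone_orbit b 0 \<mu>" and "r \<equiv> zone_orbit a (b - a) \<mu>"
  shows "{\<phi>. limit_cycle a b \<mu> \<phi>} = {l, m, r}" "card {l, m, r} = 3"
    and "hyperbolic a b \<mu> l" "hyperbolic a b \<mu> m" "hyperbolic a b \<mu> r"
    and "b > 0 \<Longrightarrow> asymptotically_stable a b \<mu> l" "b > 0 \<Longrightarrow> asymptotically_stable a b \<mu> r"
    and "b > 0 \<Longrightarrow> unstable a b \<mu> m"
    and "b < 0 \<Longrightarrow> unstable a b \<mu> l" "b < 0 \<Longrightarrow> unstable a b \<mu> r"
    and "b < 0 \<Longrightarrow> asymptotically_stable a b \<mu> m"
proof -
  have a0: "a \<noteq> 0" and b0: "b \<noteq> 0" using ab by auto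
  have sign: "b > 0 \<Longrightarrow> a < 0" "b < 0 \<Longrightarrow> a > 0" using ab by (auto simp: mult_less_0_iff)
  have loc_l: "located_in l {..-1}" unfolding l_def using located_in_left_iff[OF ab] mu_outer by blast
  have loc_m: "located_in m {-1..1}" unfolding m_def using located_in_middle_iff mu_inner by blast
  have loc_r: "located_in r {1..}" unfolding r_def using located_in_right_iff[OF ab] mu_outer by blast
  have l: "l t \<le> -1" and m: "\<bar>m t\<bar> \<le> 1" and r: "1 \<le> r t" for t
    using loc_l loc_m loc_r by (auto simp: located_in_def abs_le_iff minus_le_iff)
  have per_l: "periodic_solution a b \<mu> l"
    unfolding l_def by (rule periodic_solution_zone_orbit[OF a0]) (use l pwl_left in \<open>simp add: l_def\<close>)
  have per_m: "periodic_solution a b \<mu> m"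
    unfolding m_def by (rule periodic_solution_zone_orbit[OF b0]) (use m pwl_inner in \<open>simp add: m_def\<close>)
  have per_r: "periodic_solution a b \<mu> r"
    unfolding r_def by (rule periodic_solution_zone_orbit[OF a0]) (use r pwl_right in \<open>simp add: r_def\<close>)
  note sol = per_l[THEN periodic_solutionD(1)] per_m[THEN periodic_solutionD(1)] per_r[THEN periodic_solutionD(1)]

  \<comment> \<open>These are the times at which some orbit can meet a corner: an outer orbit at a
    level \<open>- b / a\<close> or \<open>b / a\<close> of its oscillation about the centre, the
    middle one at 1 or -1.\<close>
  define N where "N = {t. forced_response a \<mu> t = - b / a} \<union> {t. forced_response a \<mu> t = b / a}
    \<union> {t. forced_response b \<mu> t = 1} \<union> {t. forced_response b \<mu> t = -1}"
  have "\<bar>b / a\<bar> = - b / a" using ab sign b0 by (cases "b > 0") (auto simp: abs_if divide_less_0_iff)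
  then have "countable N"
    unfolding N_def using mu_outer mu_inner a0 b0
    by (intro countable_Un countable_forced_response_eq) auto
  \<comment> \<open>Uncountability of the line provides a time when all three orbits are strictly
    inside their zones, which also separates them.\<close>
  then obtain t1 where "t1 \<notin> N" using uncountable_UNIV_real by (metis UNIV_eq_I)
  have strict: "l t < -1" "\<bar>m t\<bar> < 1" "1 < r t" if "t \<notin> N" for t
  proof -
    have "l t \<noteq> -1" "m t \<noteq> 1" "m t \<noteq> -1" "r t \<noteq> 1"
      using that a0 by (auto simp: N_def l_def m_def r_def zone_orbit_def diff_divide_distrib)
    then show "l t < -1" "\<bar>m t\<bar> < 1" "1 < r t" using l[of t] m[of t] r[of t] by linarith+
  qed
  note t1 = strict[OF \<open>t1 \<notin> N\<close>]
  then have "l t1 < m t1" "m t1 < r t1" by linarith+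
  then have "l \<noteq> m" "m \<noteq> r" "l \<noteq> r" by auto
  then show "card {l, m, r} = 3" by simp

  note zone_l = periodic_solution_in_zone[OF per_l \<open>countable N\<close> pwl_DERIV_left[OF strict(1)] a0]
  note zone_m = periodic_solution_in_zone[OF per_m \<open>countable N\<close> pwl_DERIV_inner[OF strict(2)] b0]
  note zone_r = periodic_solution_in_zone[OF per_r \<open>countable N\<close> pwl_DERIV_right[OF strict(3)] a0]
  show "hyperbolic a b \<mu> l" by (rule zone_l(2))
  show "hyperbolic a b \<mu> m" by (rule zone_m(2))
  show "hyperbolic a b \<mu> r" by (rule zone_r(2))
  show "b > 0 \<Longrightarrow> asymptotically_stable a b \<mu> l" by (rule zone_l(3)[OF _ sign(1)])
  show "b > 0 \<Longrightarrow> asymptotically_stable a b \<mu> r" by (rule zone_r(3)[OF _ sign(1)])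
  show "b > 0 \<Longrightarrow> unstable a b \<mu> m" by (rule zone_m(4))
  show "b < 0 \<Longrightarrow> unstable a b \<mu> l" by (rule zone_l(4)[OF _ sign(2)])
  show "b < 0 \<Longrightarrow> unstable a b \<mu> r" by (rule zone_r(4)[OF _ sign(2)])
  show "b < 0 \<Longrightarrow> asymptotically_stable a b \<mu> m" by (rule zone_m(3))

  have "\<psi> \<in> {l, m, r}" if \<psi>: "periodic_solution a b \<mu> \<psi>" for \<psi>
  proof (rule ccontr)
    assume n: "\<psi> \<notin> {l, m, r}"
    note sol\<psi> = \<psi>[THEN periodic_solutionD(1)]
    have "\<psi> 0 \<noteq> l 0" "\<psi> 0 \<noteq> m 0" "\<psi> 0 \<noteq> r 0"
      using n solution_unique[OF sol\<psi>] sol by blast+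
    moreover have "l 0 < m 0" "m 0 < r 0"
      using solution_less[OF sol(1,2) \<open>l t1 < m t1\<close>] solution_less[OF sol(2,3) \<open>m t1 < r t1\<close>] by auto
    ultimately consider "\<psi> 0 < l 0" | "l 0 < \<psi> 0" "\<psi> 0 < m 0" | "m 0 < \<psi> 0" "\<psi> 0 < r 0" | "r 0 < \<psi> 0"
      by linarith
    then show False
    proof cases
      case 1
      \<comment> \<open>A solution below the left orbit never leaves the left zone, where the
        periodic solution is unique.\<close>
      then have "\<psi> t < l t" for t by (rule solution_less[OF sol\<psi> sol(1)])
      then have "located_in \<psi> {..-1}"
        using l by (auto simp: located_in_def intro: order_trans[OF less_imp_le])
      then have "\<psi> = l" unfolding l_def by (rule periodic_solution_in_linearity_zone(1)[OF ab \<psi>])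
      with n show False by simp
    next
      case 2
      \<comment> \<open>Reflection carries the gap between \<open>l\<close> and \<open>m\<close> to
        the one between \<open>m\<close> and \<open>r\<close>, so the exclusion on the right applies
        to the reflected \<open>\<psi>\<close>.\<close>
      have reflect: "(\<lambda>t. - m (t + pi)) = m" "(\<lambda>t. - l (t + pi)) = r"
        unfolding m_def l_def r_def zone_orbit_reflect by simp_all
      have "- m pi < - \<psi> pi" "- \<psi> pi < - l pi"
        using solution_less[OF sol\<psi> sol(2) 2(2), of pi] solution_less[OF sol(1) sol\<psi> 2(1), of pi] by auto
      then have "m 0 < - \<psi> (0 + pi)" "- \<psi> (0 + pi) < r 0"
        using fun_cong[OF reflect(1), of 0] fun_cong[OF reflect(2), of 0] by auto
      then show False
        using no_periodic_solution_between[OF ab per_m m per_r r periodic_solution_reflect[OF \<psi>], of t1] t1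
        by (simp add: abs_less_iff)
    next
      case 3
      then show False
        using no_periodic_solution_between[OF ab per_m m per_r r \<psi>, of t1] t1 by (simp add: abs_less_iff)
    next
      case 4
      then have "r t < \<psi> t" for t by (rule solution_less[OF sol(3) sol\<psi>])
      then have "located_in \<psi> {1..}"
        using r by (auto simp: located_in_def intro: order_trans[OF _ less_imp_le])
      then have "\<psi> = r" unfolding r_def by (rule periodic_solution_in_linearity_zone(3)[OF ab \<psi>])
      with n show False by simp
    qed
  qed
  then show "{\<phi>. limit_cycle a b \<mu> \<phi>} = {l, m, r}"
    using zone_l(1) zone_m(1) zone_r(1) unfolding limit_cycle_def by blast
qed

text \<open>A limit cycle inside a zone is the sinusoid of that zone, so there are only three
  candidates. A count of three forces each of them to occur, hence to lie in its zone.\<close>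

lemma mu_bound_of_three_limit_cycles:
  assumes ab: "a * b < 0" and card: "card {\<phi>. limit_cycle a b \<mu> \<phi>} = 3"
    and zones: "\<And>\<phi>. limit_cycle a b \<mu> \<phi> \<Longrightarrow> \<exists>Z\<in>linearity_zones. located_in \<phi> Z"
  shows "\<bar>\<mu>\<bar> \<le> - b * sqrt (a\<^sup>2 + 1) / a" "\<bar>\<mu>\<bar> \<le> sqrt (b\<^sup>2 + 1)"
proof -
  define l m r where "l = zone_orbit a (a - b) \<mu>" and "m = zone_orbit b 0 \<mu>"
    and "r = zone_orbit a (b - a) \<mu>"
  have sub: "\<phi> = l \<and> located_in l {..-1} \<or> \<phi> = m \<and> located_in m {-1..1} \<or> \<phi> = r \<and> located_in r {1..}"
    if "limit_cycle a b \<mu> \<phi>" for \<phi>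
  proof -
    have \<phi>: "periodic_solution a b \<mu> \<phi>" using that by (simp add: limit_cycle_def)
    from zones[OF that] consider "located_in \<phi> {..-1}" | "located_in \<phi> {-1..1}" | "located_in \<phi> {1..}"
      unfolding linearity_zones_def by blast
    then show ?thesis
      using periodic_solution_in_linearity_zone[OF ab \<phi>] unfolding l_def m_def r_def
      by cases metis+
  qed
  have no_pair: "\<not> {\<phi>. limit_cycle a b \<mu> \<phi>} \<subseteq> {\<psi>, \<psi>'}" for \<psi> \<psi>'
  proof
    assume "{\<phi>. limit_cycle a b \<mu> \<phi>} \<subseteq> {\<psi>, \<psi>'}"
    then have "card {\<phi>. limit_cycle a b \<mu> \<phi>} \<le> card {\<psi>, \<psi>'}" by (rule card_mono[rotated]) simp
    also have "\<dots> \<le> 2" by (simp add: card_insert_if)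
    finally show False using card by simp
  qed
  have "located_in r {1..}" using sub no_pair[of l m] by blast
  then show "\<bar>\<mu>\<bar> \<le> - b * sqrt (a\<^sup>2 + 1) / a" unfolding r_def located_in_right_iff[OF ab] .
  have "located_in m {-1..1}" using sub no_pair[of l r] by blast
  then show "\<bar>\<mu>\<bar> \<le> sqrt (b\<^sup>2 + 1)" unfolding m_def located_in_middle_iff .
qed

text \<open>Since \<open>card\<close> is 0 on infinite sets, the value 3 includes finiteness. The
  witnesses for the second part are the three zone orbits.\<close>

theorem theorem5p4:
  fixes a b \<mu> :: real
  assumes "a * b < 0"
  shows
    "((card {\<phi>. limit_cycle a b \<mu> \<phi>} = 3 \<and>
       (\<forall>\<phi>. limit_cycle a b \<mu> \<phi> \<longrightarrow> (\<exists>Z\<in>linearity_zones. located_in \<phi> Z)))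
      \<longleftrightarrow> \<bar>\<mu>\<bar> \<le> min (- b * sqrt (a\<^sup>2 + 1) / a) (sqrt (b\<^sup>2 + 1)))
     \<and>
     (\<bar>\<mu>\<bar> \<le> min (- b * sqrt (a\<^sup>2 + 1) / a) (sqrt (b\<^sup>2 + 1)) \<longrightarrow>
      (\<exists>\<phi>\<^sub>l \<phi>\<^sub>m \<phi>\<^sub>r.
         {\<phi>. limit_cycle a b \<mu> \<phi>} = {\<phi>\<^sub>l, \<phi>\<^sub>m, \<phi>\<^sub>r} \<and>
         located_in \<phi>\<^sub>l {..-1} \<and> located_in \<phi>\<^sub>m {-1..1} \<and> located_in \<phi>\<^sub>r {1..} \<and>
         hyperbolic a b \<mu> \<phi>\<^sub>l \<and> hyperbolic a b \<mu> \<phi>\<^sub>m \<and> hyperbolic a b \<mu> \<phi>\<^sub>r \<and>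
         (b > 0 \<longrightarrow>
            asymptotically_stable a b \<mu> \<phi>\<^sub>l \<and> asymptotically_stable a b \<mu> \<phi>\<^sub>r \<and>
            unstable a b \<mu> \<phi>\<^sub>m) \<and>
         (b < 0 \<longrightarrow>
            unstable a b \<mu> \<phi>\<^sub>l \<and> unstable a b \<mu> \<phi>\<^sub>r \<and>
            asymptotically_stable a b \<mu> \<phi>\<^sub>m)))"
proof -
  let ?l = "zone_orbit a (a - b) \<mu>" and ?m = "zone_orbit b 0 \<mu>" and ?r = "zone_orbit a (b - a) \<mu>"
  have loc: "located_in ?l {..-1}" "located_in ?m {-1..1}" "located_in ?r {1..}"
    and cycles: "{\<phi>. limit_cycle a b \<mu> \<phi>} = {?l, ?m, ?r}" "card {?l, ?m, ?r} = 3"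
    and hyp: "hyperbolic a b \<mu> ?l" "hyperbolic a b \<mu> ?m" "hyperbolic a b \<mu> ?r"
    and pos: "b > 0 \<longrightarrow> asymptotically_stable a b \<mu> ?l \<and> asymptotically_stable a b \<mu> ?r \<and> unstable a b \<mu> ?m"
    and neg: "b < 0 \<longrightarrow> unstable a b \<mu> ?l \<and> unstable a b \<mu> ?r \<and> asymptotically_stable a b \<mu> ?m"
    if "\<bar>\<mu>\<bar> \<le> min (- b * sqrt (a\<^sup>2 + 1) / a) (sqrt (b\<^sup>2 + 1))"
  proof -
    have mu: "\<bar>\<mu>\<bar> \<le> - b * sqrt (a\<^sup>2 + 1) / a" "\<bar>\<mu>\<bar> \<le> sqrt (b\<^sup>2 + 1)" using that by auto
    show "located_in ?l {..-1}" "located_in ?m {-1..1}" "located_in ?r {1..}"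
      unfolding located_in_left_iff[OF assms] located_in_middle_iff located_in_right_iff[OF assms]
      by (rule mu)+
    note three = three_limit_cycles[OF assms mu]
    show "{\<phi>. limit_cycle a b \<mu> \<phi>} = {?l, ?m, ?r}" "card {?l, ?m, ?r} = 3"
      "hyperbolic a b \<mu> ?l" "hyperbolic a b \<mu> ?m" "hyperbolic a b \<mu> ?r"
      by (rule three)+
    show "b > 0 \<longrightarrow> asymptotically_stable a b \<mu> ?l \<and> asymptotically_stable a b \<mu> ?r \<and> unstable a b \<mu> ?m"
      "b < 0 \<longrightarrow> unstable a b \<mu> ?l \<and> unstable a b \<mu> ?r \<and> asymptotically_stable a b \<mu> ?m"
      by (intro impI conjI three; assumption)+
  qed
  show ?thesis
  proof (rule conjI, rule iffI)
    assume "card {\<phi>. limit_cycle a b \<mu> \<phi>} = 3 \<and>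
      (\<forall>\<phi>. limit_cycle a b \<mu> \<phi> \<longrightarrow> (\<exists>Z\<in>linearity_zones. located_in \<phi> Z))"
    then show "\<bar>\<mu>\<bar> \<le> min (- b * sqrt (a\<^sup>2 + 1) / a) (sqrt (b\<^sup>2 + 1))"
      using mu_bound_of_three_limit_cycles[OF assms] by simp
  next
    assume mu: "\<bar>\<mu>\<bar> \<le> min (- b * sqrt (a\<^sup>2 + 1) / a) (sqrt (b\<^sup>2 + 1))"
    have "\<exists>Z\<in>linearity_zones. located_in \<phi> Z" if "limit_cycle a b \<mu> \<phi>" for \<phi>
    proof -
      have "\<phi> \<in> {?l, ?m, ?r}" using that cycles(1)[OF mu] by blast
      then show ?thesis using loc[OF mu] by (auto simp: linearity_zones_def)
    qed
    then show "card {\<phi>. limit_cycle a b \<mu> \<phi>} = 3 \<and>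
      (\<forall>\<phi>. limit_cycle a b \<mu> \<phi> \<longrightarrow> (\<exists>Z\<in>linearity_zones. located_in \<phi> Z))"
      unfolding cycles(1)[OF mu] using cycles(2)[OF mu] by blast
  next
    show "\<bar>\<mu>\<bar> \<le> min (- b * sqrt (a\<^sup>2 + 1) / a) (sqrt (b\<^sup>2 + 1)) \<longrightarrow>
      (\<exists>\<phi>\<^sub>l \<phi>\<^sub>m \<phi>\<^sub>r.
         {\<phi>. limit_cycle a b \<mu> \<phi>} = {\<phi>\<^sub>l, \<phi>\<^sub>m, \<phi>\<^sub>r} \<and>
         located_in \<phi>\<^sub>l {..-1} \<and> located_in \<phi>\<^sub>m {-1..1} \<and> located_in \<phi>\<^sub>r {1..} \<and>
         hyperbolic a b \<mu> \<phi>\<^sub>l \<and> hyperbolic a b \<mu> \<phi>\<^sub>m \<and> hyperbolic a b \<mu> \<phi>\<^sub>r \<and>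
         (b > 0 \<longrightarrow>
            asymptotically_stable a b \<mu> \<phi>\<^sub>l \<and> asymptotically_stable a b \<mu> \<phi>\<^sub>r \<and>
            unstable a b \<mu> \<phi>\<^sub>m) \<and>
         (b < 0 \<longrightarrow>
            unstable a b \<mu> \<phi>\<^sub>l \<and> unstable a b \<mu> \<phi>\<^sub>r \<and>
            asymptotically_stable a b \<mu> \<phi>\<^sub>m))"
    proof (rule impI, rule exI[of _ ?l], rule exI[of _ ?m], rule exI[of _ ?r])
      assume mu: "\<bar>\<mu>\<bar> \<le> min (- b * sqrt (a\<^sup>2 + 1) / a) (sqrt (b\<^sup>2 + 1))"
      show "{\<phi>. limit_cycle a b \<mu> \<phi>} = {?l, ?m, ?r} \<and>
         located_in ?l {..-1} \<and> located_in ?m {-1..1} \<and> located_in ?r {1..} \<and>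
         hyperbolic a b \<mu> ?l \<and> hyperbolic a b \<mu> ?m \<and> hyperbolic a b \<mu> ?r \<and>
         (b > 0 \<longrightarrow>
            asymptotically_stable a b \<mu> ?l \<and> asymptotically_stable a b \<mu> ?r \<and> unstable a b \<mu> ?m) \<and>
         (b < 0 \<longrightarrow>
            unstable a b \<mu> ?l \<and> unstable a b \<mu> ?r \<and> asymptotically_stable a b \<mu> ?m)"
        by (intro conjI cycles(1)[OF mu] loc[OF mu] hyp[OF mu] pos[OF mu] neg[OF mu])
    qed
  qed
qed

end
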